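(* Let $\Omega$ be a bounded domain in $\mathbb{R}^m$ with $m\ge2$, and let $v,u\in C^2(\Omega)\cap C^0(\bar\Omega)$ satisfy $$H_{\vec F}(v)\le H_{\vec F}(u)\ \text{ in }\Omega\setminus\{S_{\vec F}(u)\cup S_{\vec F}(v)\},\qquad v\ge u\ \text{ on }\partial\Omega.$$ Suppose $\mathcal{H}_{m-1}(\overline{S_{\vec F}(u)\cup S_{\vec F}(v)})=0$ and $\vec F\in C^1(\Omega)\cap C^0(\bar\Omega)$ satisfies $\operatorname{div}\vec F^{\,b}>0$ in $\Omega$ (respectively, $\operatorname{div}\vec F^{\,b}<0$ in $\Omega$). Then $v\ge u$ in $\Omega$.
   Context: $\vec F$ is a vector field on $\Omega$. $S_{\vec F}(u):=\{\nabla u+\vec F=0\}\subset\Omega$ is the set of singular points of $u$; off it, $N_{\vec F}(u):=\frac{\nabla u+\vec F}{|\nabla u+\vec F|}$ and $H_{\vec F}(u):=\operatorname{div}N_{\vec F}(u)$ (Euclidean); similarly for $v$. $\mathcal{H}_{m-1}$ is $(m-1)$-dimensional Hausdorff measure. For $\vec G=(G_1,\dots,G_m)$, $\vec G^{\,b}:=(\sum_ka^{1k}G_k,\dots,\sum_ka^{mk}G_k)$, where $a^{jk}$ are (fixed) real constants with $a^{jk}+a^{kj}=0$ for $1\le j,k\le m$. *)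

theory Defs
  imports "HOL-Analysis.Analysis"
begin

text \<open>\<open>Ck_on k f S\<close> is meant for open \<open>S\<close>: all directional derivatives of order at most \<open>k\<close>
  exist (as values of iterated Frechet derivatives) and are continuous on \<open>S\<close>.\<close>

primrec Ck_on :: "nat \<Rightarrow> ('a::real_normed_vector \<Rightarrow> 'b::real_normed_vector) \<Rightarrow> 'a set \<Rightarrow> bool" where
  "Ck_on 0 f S \<longleftrightarrow> continuous_on S f"
| "Ck_on (Suc k) f S \<longleftrightarrow>
     (\<forall>x\<in>S. f differentiable (at x)) \<and>
     (\<forall>h. Ck_on k (\<lambda>x. frechet_derivative f (at x) h) S)"

definition partial_deriv :: "'n::finite \<Rightarrow> (real^'n \<Rightarrow> real) \<Rightarrow> real^'n \<Rightarrow> real" where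
  "partial_deriv i f x = frechet_derivative f (at x) (axis i 1)"

definition grad :: "(real^'n::finite \<Rightarrow> real) \<Rightarrow> real^'n \<Rightarrow> real^'n" where
  "grad f x = (\<chi> i. partial_deriv i f x)"

definition divergence :: "(real^'n::finite \<Rightarrow> real^'n) \<Rightarrow> real^'n \<Rightarrow> real" where
  "divergence G x = (\<Sum>i\<in>UNIV. partial_deriv i (\<lambda>y. G y $ i) x)"

definition singular_set ::
  "(real^'n::finite) set \<Rightarrow> (real^'n \<Rightarrow> real^'n) \<Rightarrow> (real^'n \<Rightarrow> real) \<Rightarrow> (real^'n) set" where
  "singular_set \<Omega> F u = {x\<in>\<Omega>. grad u x + F x = 0}"

text \<open>The next two are meaningful only off the singular set; on it, the normal takes the
  junk value 0.\<close>

definition unit_normal ::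
  "(real^'n::finite \<Rightarrow> real^'n) \<Rightarrow> (real^'n \<Rightarrow> real) \<Rightarrow> real^'n \<Rightarrow> real^'n" where
  "unit_normal F u x = (grad u x + F x) /\<^sub>R norm (grad u x + F x)"

definition mean_curv ::
  "(real^'n::finite \<Rightarrow> real^'n) \<Rightarrow> (real^'n \<Rightarrow> real) \<Rightarrow> real^'n \<Rightarrow> real" where
  "mean_curv F u = divergence (unit_normal F u)"

text \<open>The field \<open>G\<^sup>b\<close>, with the constants \<open>a\<^sup>j\<^sup>k\<close> collected in a matrix.\<close>

definition b_field :: "real^'n^'n \<Rightarrow> (real^'n::finite \<Rightarrow> real^'n) \<Rightarrow> real^'n \<Rightarrow> real^'n" where
  "b_field a G x = (\<chi> j. \<Sum>k\<in>UNIV. a $ j $ k * G x $ k)"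

text \<open>The \<open>k\<close>-dimensional Hausdorff (outer) measure, with the usual normalisation that makes it
  agree with Lebesgue measure on \<open>k\<close>-dimensional Euclidean space. Empty pieces are given
  weight 0, so that \<open>k = 0\<close> yields counting measure. Boundedness of the pieces is required
  because \<^const>\<open>diameter\<close> is unspecified for unbounded sets.\<close>

definition hausdorff_weight :: "nat \<Rightarrow> 'a::metric_space set \<Rightarrow> ennreal" where
  "hausdorff_weight k U =
     (if U = {} then 0 else ennreal (unit_ball_vol (real k) * (diameter U / 2) ^ k))"

definition hausdorff_premeasure :: "nat \<Rightarrow> real \<Rightarrow> 'a::metric_space set \<Rightarrow> ennreal" where
  "hausdorff_premeasure k \<delta> A =
     (INF U \<in> {U :: nat \<Rightarrow> 'a set. A \<subseteq> (\<Union>i. U i) \<and> (\<forall>i. bounded (U i) \<and> diameter (U i) \<le> \<delta>)}.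
        (\<Sum>i. hausdorff_weight k (U i)))"

definition hausdorff_measure :: "nat \<Rightarrow> 'a::metric_space set \<Rightarrow> ennreal" where
  "hausdorff_measure k A = (SUP \<delta> \<in> {0<..}. hausdorff_premeasure k \<delta> A)"

end

theory Submission
  imports Defs
begin

text \<open>Write \<open>p = grad u + F\<close>, \<open>q = grad v + F\<close>, so that \<open>p - q = grad (u - v)\<close> and
  \<open>(p - q) \<bullet> (sgn p - sgn q) = (|p| + |q|) / 2 * |sgn p - sgn q|\<^sup>2\<close>. Testing the curvature
  inequality on \<open>{u - v > \<epsilon>}\<close>, with a cutoff near the \<open>\<H>\<^sub>m\<^sub>-\<^sub>1\<close>-null singular set, gives
  \<open>sgn p = sgn q\<close> there. Hence the skew matrix \<open>a\<close> maps \<open>p\<close> to a vector orthogonal to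
  \<open>grad (u - v)\<close>, also at singular points. For \<open>\<phi> = ((u - v - \<epsilon>)\<^sup>+)\<^sup>2\<close> the field \<open>\<phi> a p\<close> therefore has
  divergence \<open>\<phi> div (a F)\<close>, the second derivatives of \<open>u\<close> cancelling by skewness. It has compact
  support, so the integral of its divergence vanishes and the sign of \<open>div (a F)\<close> forces \<open>\<phi> = 0\<close>.\<close>

subsection \<open>Continuously differentiable functions\<close>

text \<open>\<open>Ck_on 1\<close> for scalar functions, repackaged through the gradient vector.
  Vector fields are treated componentwise, so sums, products and compositions of scalar functions
  suffice as a calculus.\<close>

definition C1_on :: "(real^'n::finite \<Rightarrow> real) \<Rightarrow> (real^'n) set \<Rightarrow> bool" where
  "C1_on f S \<longleftrightarrow> (\<forall>x\<in>S. f differentiable (at x)) \<and> continuous_on S (grad f)"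

text \<open>\<open>grad\<close> only records the derivatives along the coordinate axes; expanding
  \<open>h\<close> in the standard basis recovers the whole derivative by linearity.\<close>

lemma has_derivative_grad:
  assumes "f differentiable (at x)"
  shows "(f has_derivative (\<lambda>h. grad f x \<bullet> h)) (at x)"
proof -
  let ?D = "frechet_derivative f (at x)"
  have lin: "linear ?D"
    using assms by (rule linear_frechet_derivative)
  have "?D h = grad f x \<bullet> h" for h
  proof -
    have "?D h = ?D (\<Sum>i\<in>UNIV. h $ i *\<^sub>R axis i 1)"
      using basis_expansion[of h] by (simp add: scalar_mult_eq_scaleR)
    also have "\<dots> = (\<Sum>i\<in>UNIV. h $ i * ?D (axis i 1))"
      by (simp add: linear_sum[OF lin] linear_cmul[OF lin])
    finally show ?thesis
      by (simp add: grad_def partial_deriv_def inner_vec_def mult.commute)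
  qed
  then have "?D = (\<lambda>h. grad f x \<bullet> h)" by auto
  then show ?thesis
    using assms frechet_derivative_works by metis
qed

lemma grad_eqI:
  assumes "(f has_derivative (\<lambda>h. g \<bullet> h)) (at x)"
  shows "grad f x = g"
  using frechet_derivative_at[OF assms, symmetric]
  by (simp add: grad_def partial_deriv_def inner_axis vec_eq_iff)

lemma C1_onD:
  assumes "C1_on f S"
  shows "x \<in> S \<Longrightarrow> f differentiable (at x)"
    and "x \<in> S \<Longrightarrow> (f has_derivative (\<lambda>h. grad f x \<bullet> h)) (at x)"
    and "continuous_on S (grad f)" and "continuous_on S f"
  using assms has_derivative_grad
  by (auto simp: C1_on_def
      intro!: differentiable_imp_continuous_on differentiable_at_imp_differentiable_on)

lemma C1_onI:
  assumes "\<And>x. x \<in> S \<Longrightarrow> (f has_derivative (\<lambda>h. g x \<bullet> h)) (at x)"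
    and "continuous_on S g"
  shows "C1_on f S"
proof -
  have "grad f x = g x" if "x \<in> S" for x
    using assms(1)[OF that] by (rule grad_eqI)
  then have "continuous_on S (grad f)"
    using assms(2) by (metis continuous_on_cong)
  then show ?thesis
    using assms(1) by (auto simp: C1_on_def differentiable_def)
qed

lemma C1_on_subset: "C1_on f S \<Longrightarrow> T \<subseteq> S \<Longrightarrow> C1_on f T"
  by (auto simp: C1_on_def intro: continuous_on_subset)

lemma
  assumes "f differentiable (at x)" "g differentiable (at x)"
  shows grad_add: "grad (\<lambda>x. f x + g x) x = grad f x + grad g x"
    and grad_diff: "grad (\<lambda>x. f x - g x) x = grad f x - grad g x"
    and grad_mult: "grad (\<lambda>x. f x * g x) x = f x *\<^sub>R grad g x + g x *\<^sub>R grad f x"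
proof -
  note [derivative_intros] = assms[THEN has_derivative_grad]
  show "grad (\<lambda>x. f x + g x) x = grad f x + grad g x"
    by (rule grad_eqI) (auto intro!: derivative_eq_intros simp: inner_add_left)
  show "grad (\<lambda>x. f x - g x) x = grad f x - grad g x"
    by (rule grad_eqI) (auto intro!: derivative_eq_intros simp: inner_diff_left)
  show "grad (\<lambda>x. f x * g x) x = f x *\<^sub>R grad g x + g x *\<^sub>R grad f x"
    by (rule grad_eqI) (auto intro!: derivative_eq_intros simp: inner_add_left algebra_simps)
qed

lemma grad_const [simp]: "grad (\<lambda>x. c) x = 0"
  by (rule grad_eqI) auto

lemma grad_cmult: "f differentiable (at x) \<Longrightarrow> grad (\<lambda>x. c * f x) x = c *\<^sub>R grad f x"
  by (simp add: grad_mult)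

lemma grad_sum:
  assumes "\<And>i. i \<in> I \<Longrightarrow> f i differentiable (at x)"
  shows "grad (\<lambda>x. \<Sum>i\<in>I. f i x) x = (\<Sum>i\<in>I. grad (f i) x)"
  using assms
  by (intro grad_eqI) (auto intro!: derivative_eq_intros has_derivative_grad simp: inner_sum_left)

lemma has_derivative_compose_grad:
  assumes "f differentiable (at x)" "(g has_real_derivative g') (at (f x))"
  shows "((\<lambda>x. g (f x)) has_derivative (\<lambda>h. (g' *\<^sub>R grad f x) \<bullet> h)) (at x)"
  using has_derivative_compose[OF has_derivative_grad[OF assms(1)]
      assms(2)[unfolded has_field_derivative_def]]
  by simp

lemmas grad_compose = has_derivative_compose_grad[THEN grad_eqI]

lemma C1_on_const: "C1_on (\<lambda>x. c) S"
  by (rule C1_onI[where g = "\<lambda>_. 0"]) auto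

lemma C1_on_add: "C1_on f S \<Longrightarrow> C1_on g S \<Longrightarrow> C1_on (\<lambda>x. f x + g x) S"
  by (rule C1_onI[where g = "\<lambda>x. grad f x + grad g x"])
     (auto intro!: derivative_eq_intros continuous_intros dest: C1_onD simp: inner_add_left)

lemma C1_on_diff: "C1_on f S \<Longrightarrow> C1_on g S \<Longrightarrow> C1_on (\<lambda>x. f x - g x) S"
  by (rule C1_onI[where g = "\<lambda>x. grad f x - grad g x"])
     (auto intro!: derivative_eq_intros continuous_intros dest: C1_onD simp: inner_diff_left)

lemma C1_on_mult: "C1_on f S \<Longrightarrow> C1_on g S \<Longrightarrow> C1_on (\<lambda>x. f x * g x) S"
  by (rule C1_onI[where g = "\<lambda>x. f x *\<^sub>R grad g x + g x *\<^sub>R grad f x"])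
     (auto intro!: derivative_eq_intros continuous_intros dest: C1_onD
       simp: inner_add_left algebra_simps)

lemma C1_on_sum: "(\<And>i. i \<in> I \<Longrightarrow> C1_on (f i) S) \<Longrightarrow> C1_on (\<lambda>x. \<Sum>i\<in>I. f i x) S"
  by (rule C1_onI[where g = "\<lambda>x. \<Sum>i\<in>I. grad (f i) x"])
     (auto intro!: derivative_eq_intros continuous_intros dest: C1_onD simp: inner_sum_left)

text \<open>Continuity of \<open>g'\<close> is asked on the image of \<open>f\<close> only, which
  admits outer functions such as \<open>inverse (sqrt t)\<close> when \<open>f\<close> is
  positive.\<close>

lemma C1_on_compose:
  assumes f: "C1_on f S" and g: "\<And>x. x \<in> S \<Longrightarrow> (g has_real_derivative g' (f x)) (at (f x))"
    and g': "continuous_on (f ` S) g'"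
  shows "C1_on (\<lambda>x. g (f x)) S"
proof (rule C1_onI)
  show "((\<lambda>x. g (f x)) has_derivative (\<lambda>h. (g' (f x) *\<^sub>R grad f x) \<bullet> h)) (at x)" if "x \<in> S" for x
    using that f g by (intro has_derivative_compose_grad) (auto dest: C1_onD)
  show "continuous_on S (\<lambda>x. g' (f x) *\<^sub>R grad f x)"
    using f g' by (intro continuous_intros continuous_on_compose2[OF g']) (auto dest: C1_onD)
qed

lemma Ck_on_1_component:
  assumes "Ck_on 1 F S"
  shows "C1_on (\<lambda>x. F x $ i) S"
proof (rule C1_onI)
  let ?D = "\<lambda>x. frechet_derivative F (at x)"
  have dF: "(F has_derivative ?D x) (at x)" if "x \<in> S" for x
    using assms that by (auto simp: frechet_derivative_works[symmetric])
  then have dFi: "((\<lambda>x. F x $ i) has_derivative (\<lambda>h. ?D x h $ i)) (at x)" if "x \<in> S" for x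
    using bounded_linear.has_derivative[OF bounded_linear_vec_nth] that by blast
  have eq: "grad (\<lambda>x. F x $ i) x = (\<chi> j. ?D x (axis j 1) $ i)" if "x \<in> S" for x
    using frechet_derivative_at[OF dFi[OF that], symmetric]
    by (simp add: grad_def partial_deriv_def)
  show "((\<lambda>x. F x $ i) has_derivative (\<lambda>h. (\<chi> j. ?D x (axis j 1) $ i) \<bullet> h)) (at x)"
    if "x \<in> S" for x
    using has_derivative_grad[of "\<lambda>x. F x $ i" x] dFi[OF that] eq[OF that]
    by (auto simp: differentiable_def)
  show "continuous_on S (\<lambda>x. \<chi> j. ?D x (axis j 1) $ i)"
    using assms by (auto intro!: continuous_intros)
qed

lemma Ck_on_1_C1_on:
  fixes f :: "real^'n \<Rightarrow> real"
  assumes "Ck_on 1 f S"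
  shows "C1_on f S"
proof -
  have "continuous_on S (grad f)"
    using assms unfolding grad_def partial_deriv_def by (auto intro!: continuous_intros)
  then show ?thesis using assms by (simp add: C1_on_def)
qed

lemma Ck_on_2_grad:
  fixes f :: "real^'n \<Rightarrow> real"
  assumes "Ck_on 2 f S"
  shows "C1_on (\<lambda>x. grad f x $ i) S"
proof -
  have "Ck_on 1 (\<lambda>x. frechet_derivative f (at x) (axis i 1)) S"
    using assms by (simp add: numeral_2_eq_2)
  from Ck_on_1_C1_on[OF this] show ?thesis
    by (simp add: grad_def partial_deriv_def)
qed

text \<open>At order 2 the recursion of \<open>Ck_on\<close> does not list continuity of the first
  derivatives; it follows from their differentiability.\<close>

lemma Ck_on_2_C1_on:
  fixes f :: "real^'n \<Rightarrow> real"
  assumes "Ck_on 2 f S"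
  shows "C1_on f S"
proof -
  have "continuous_on S (\<lambda>x. \<chi> i. grad f x $ i)"
    using Ck_on_2_grad[OF assms] by (intro continuous_on_vec_lambda) (auto dest: C1_onD(4))
  then show ?thesis using assms by (simp add: C1_on_def numeral_2_eq_2)
qed

section \<open>Symmetry of second derivatives\<close>

lemma second_difference_MVT:
  fixes f :: "real^'n \<Rightarrow> real" and d e :: "real^'n"
  assumes f: "C1_on f S" and fd: "C1_on (\<lambda>x. grad f x \<bullet> d) S"
    and "0 < t" and S: "\<And>r s. \<lbrakk>0 \<le> r; r \<le> t; 0 \<le> s; s \<le> t\<rbrakk> \<Longrightarrow> x + r *\<^sub>R d + s *\<^sub>R e \<in> S"
  obtains r s where "0 < r" "r < t" "0 < s" "s < t"
    "f (x + t *\<^sub>R d + t *\<^sub>R e) - f (x + t *\<^sub>R d) - f (x + t *\<^sub>R e) + f x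
       = t\<^sup>2 * (grad (\<lambda>y. grad f y \<bullet> d) (x + r *\<^sub>R d + s *\<^sub>R e) \<bullet> e)"
proof -
  \<comment> \<open>\<open>?h\<close> is the increment of \<open>f\<close> along \<open>t e\<close>,
    seen as a function of the position along \<open>d\<close>. The mean value theorem for
    \<open>?h\<close> yields \<open>r\<close>; a second application, to the derivative along
    \<open>d\<close> as a function of the position along \<open>e\<close>, yields
    \<open>s\<close>.\<close>
  let ?h = "\<lambda>r. f (x + r *\<^sub>R d + t *\<^sub>R e) - f (x + r *\<^sub>R d)"
  have der: "((\<lambda>r. f (x + r *\<^sub>R d + s *\<^sub>R e)) has_real_derivative
      grad f (x + r *\<^sub>R d + s *\<^sub>R e) \<bullet> d) (at r)"
    if "0 \<le> r" "r \<le> t" "0 \<le> s" "s \<le> t" for r s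
    unfolding has_field_derivative_def
    by (rule has_derivative_eq_rhs, rule has_derivative_compose[OF _ C1_onD(2)[OF f]])
      (auto intro!: derivative_eq_intros S that simp: fun_eq_iff)
  have "(?h has_real_derivative
      grad f (x + r *\<^sub>R d + t *\<^sub>R e) \<bullet> d - grad f (x + r *\<^sub>R d) \<bullet> d) (at r)"
    if "0 \<le> r" "r \<le> t" for r
    using der[OF that, of t] der[OF that, of 0] \<open>0 < t\<close> by (auto intro!: derivative_eq_intros)
  then obtain r where r: "0 < r" "r < t"
    "?h t - ?h 0 = (t - 0) * (grad f (x + r *\<^sub>R d + t *\<^sub>R e) \<bullet> d - grad f (x + r *\<^sub>R d) \<bullet> d)"
    using MVT2[OF \<open>0 < t\<close>, of ?h "\<lambda>r. grad f (x + r *\<^sub>R d + t *\<^sub>R e) \<bullet> d - grad f (x + r *\<^sub>R d) \<bullet> d"]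
    by auto
  let ?g = "\<lambda>s. grad f (x + r *\<^sub>R d + s *\<^sub>R e) \<bullet> d"
  have "(?g has_real_derivative grad (\<lambda>y. grad f y \<bullet> d) (x + r *\<^sub>R d + s *\<^sub>R e) \<bullet> e) (at s)"
    if "0 \<le> s" "s \<le> t" for s
    unfolding has_field_derivative_def
    by (rule has_derivative_eq_rhs, rule has_derivative_compose[OF _ C1_onD(2)[OF fd]])
      (use r in \<open>auto intro!: derivative_eq_intros S that simp: fun_eq_iff\<close>)
  then obtain s where s: "0 < s" "s < t"
    "?g t - ?g 0 = (t - 0) * (grad (\<lambda>y. grad f y \<bullet> d) (x + r *\<^sub>R d + s *\<^sub>R e) \<bullet> e)"
    using MVT2[OF \<open>0 < t\<close>, of ?g
        "\<lambda>s. grad (\<lambda>y. grad f y \<bullet> d) (x + r *\<^sub>R d + s *\<^sub>R e) \<bullet> e"]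
    by auto
  show thesis
    using r s by (intro that[of r s]) (auto simp: power2_eq_square)
qed

text \<open>The second difference over a parallelogram is unchanged when \<open>d\<close> and
  \<open>e\<close> are exchanged. Evaluating it in both orders by
  \<open>second_difference_MVT\<close> gives equal mixed derivatives at two nearby points, and both
  points tend to \<open>x\<close> as the parallelogram shrinks.\<close>

lemma second_derivative_symmetric:
  fixes f :: "real^'n \<Rightarrow> real" and d e :: "real^'n"
  assumes "open S" "x \<in> S" and f: "C1_on f S"
    and fd: "C1_on (\<lambda>x. grad f x \<bullet> d) S" and fe: "C1_on (\<lambda>x. grad f x \<bullet> e) S"
  shows "grad (\<lambda>y. grad f y \<bullet> d) x \<bullet> e = grad (\<lambda>y. grad f y \<bullet> e) x \<bullet> d"
proof -
  let ?P = "\<lambda>y. grad (\<lambda>y. grad f y \<bullet> d) y \<bullet> e" and ?Q = "\<lambda>y. grad (\<lambda>y. grad f y \<bullet> e) y \<bullet> d"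
  obtain \<rho> where \<rho>: "\<rho> > 0" "ball x \<rho> \<subseteq> S"
    using assms by (meson openE)
  \<comment> \<open>The parallelogram with sides \<open>t n * d\<close> and \<open>t n * e\<close>
    must stay in the ball of radius \<rho>; the summand 1 keeps the denominator positive when
    \<open>d\<close> and \<open>e\<close> both vanish.\<close>
  define t where "t n = \<rho> / (norm d + norm e + 1) / (2 + real n)" for n
  have pos: "norm d + norm e + 1 > 0"
    by (simp add: add_nonneg_pos)
  have t0: "t n > 0" for n
    using \<rho> pos by (auto simp: t_def)
  have tlim: "t \<longlonglongrightarrow> 0"
    unfolding t_def
    by (rule real_tendsto_divide_at_top[OF tendsto_const
          filterlim_tendsto_add_at_top[OF tendsto_const filterlim_real_sequentially]])
  have small: "norm (r *\<^sub>R d + s *\<^sub>R e) \<le> t n * (norm d + norm e)"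
    if "0 \<le> r" "r \<le> t n" "0 \<le> s" "s \<le> t n" for r s n
  proof -
    have "norm (r *\<^sub>R d + s *\<^sub>R e) \<le> r * norm d + s * norm e"
      using that by (metis abs_of_nonneg norm_scaleR norm_triangle_ineq)
    also have "\<dots> \<le> t n * norm d + t n * norm e"
      using that by (intro add_mono mult_right_mono) auto
    finally show ?thesis by (simp add: algebra_simps)
  qed
  have tbound: "t n * (norm d + norm e) < \<rho>" for n
  proof -
    have "t n * (norm d + norm e) < t n * (norm d + norm e + 1)"
      using t0 by (intro mult_strict_left_mono) auto
    also have "\<dots> = \<rho> / (2 + real n)"
      using pos by (simp add: t_def)
    also have "\<dots> \<le> \<rho>"
      using \<rho> by (simp add: field_simps)
    finally show ?thesis .
  qed
  have inS: "x + r *\<^sub>R d + s *\<^sub>R e \<in> S"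
    if "0 \<le> r" "r \<le> t n" "0 \<le> s" "s \<le> t n" for r s n
  proof -
    have "norm (r *\<^sub>R d + s *\<^sub>R e) < \<rho>"
      using small[OF that] tbound[of n] by simp
    then have "x + (r *\<^sub>R d + s *\<^sub>R e) \<in> ball x \<rho>"
      by (simp only: mem_ball dist_commute[of x]) (simp add: dist_norm)
    then show ?thesis using \<rho> by (auto simp: add.assoc)
  qed
  have "\<exists>p q. ?P p = ?Q q \<and> norm (p - x) \<le> t n * (norm d + norm e)
      \<and> norm (q - x) \<le> t n * (norm d + norm e)" for n
  proof -
    obtain r s where rs: "0 < r" "r < t n" "0 < s" "s < t n"
      "f (x + t n *\<^sub>R d + t n *\<^sub>R e) - f (x + t n *\<^sub>R d) - f (x + t n *\<^sub>R e) + f x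
       = (t n)\<^sup>2 * ?P (x + r *\<^sub>R d + s *\<^sub>R e)"
      by (rule second_difference_MVT[OF f fd t0[of n], of x e]) (rule inS | blast)+
    have inS': "x + s *\<^sub>R e + r *\<^sub>R d \<in> S"
      if "0 \<le> s" "s \<le> t n" "0 \<le> r" "r \<le> t n" for r s
      using inS[of r n s] that by (simp add: add_ac)
    obtain s' r' where rs': "0 < s'" "s' < t n" "0 < r'" "r' < t n"
      "f (x + t n *\<^sub>R e + t n *\<^sub>R d) - f (x + t n *\<^sub>R e) - f (x + t n *\<^sub>R d) + f x
       = (t n)\<^sup>2 * ?Q (x + s' *\<^sub>R e + r' *\<^sub>R d)"
      by (rule second_difference_MVT[OF f fe t0[of n], of x d]) (rule inS' | blast)+
    \<comment> \<open>Both second differences are the same number up to the order of the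
      summands.\<close>
    have "(t n)\<^sup>2 * ?P (x + r *\<^sub>R d + s *\<^sub>R e) = (t n)\<^sup>2 * ?Q (x + r' *\<^sub>R d + s' *\<^sub>R e)"
      using rs(5) rs'(5) unfolding add.assoc add.commute[of "_ *\<^sub>R e" "_ *\<^sub>R d"] by linarith
    then have "?P (x + r *\<^sub>R d + s *\<^sub>R e) = ?Q (x + r' *\<^sub>R d + s' *\<^sub>R e)"
      using t0[of n] by simp
    then show ?thesis
      using small[of r n s] small[of r' n s'] rs rs'
      by (intro exI[of _ "x + r *\<^sub>R d + s *\<^sub>R e"] exI[of _ "x + r' *\<^sub>R d + s' *\<^sub>R e"]) (auto simp: algebra_simps)
  qed
  then obtain p q where pq: "\<And>n. ?P (p n) = ?Q (q n)"
    "\<And>n. norm (p n - x) \<le> t n * (norm d + norm e)"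
    "\<And>n. norm (q n - x) \<le> t n * (norm d + norm e)"
    by metis
  have lim0: "(\<lambda>n. t n * (norm d + norm e)) \<longlonglongrightarrow> 0"
    using tendsto_mult_left_zero[OF tlim] .
  have "p \<longlonglongrightarrow> x" "q \<longlonglongrightarrow> x"
    using Lim_null_comparison[OF always_eventually lim0, of "\<lambda>n. p n - x"]
      Lim_null_comparison[OF always_eventually lim0, of "\<lambda>n. q n - x"] pq(2,3)
    by (simp_all add: LIM_zero_iff)
  moreover have "isCont ?P x" "isCont ?Q x"
    using assms C1_onD(3)[OF fd] C1_onD(3)[OF fe] continuous_on_eq_continuous_at[OF \<open>open S\<close>]
    by (auto intro!: continuous_intros)
  ultimately have "(\<lambda>n. ?P (p n)) \<longlonglongrightarrow> ?P x" "(\<lambda>n. ?Q (q n)) \<longlonglongrightarrow> ?Q x"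
    by (auto intro: isCont_tendsto_compose)
  then show ?thesis
    using pq(1) LIMSEQ_unique by auto
qed

section \<open>Algebraic rules for the divergence\<close>

lemma divergence_eq_grad: "divergence G x = (\<Sum>i\<in>UNIV. grad (\<lambda>y. G y $ i) x $ i)"
  by (simp add: divergence_def grad_def)

lemma divergence_scaleR:
  assumes "f differentiable (at x)" "\<And>i. (\<lambda>y. G y $ i) differentiable (at x)"
  shows "divergence (\<lambda>y. f y *\<^sub>R G y) x = f x * divergence G x + grad f x \<bullet> G x"
  using assms
  by (simp add: divergence_eq_grad grad_mult inner_vec_def sum.distrib sum_distrib_left algebra_simps)

lemma
  assumes "\<And>i. (\<lambda>y. G y $ i) differentiable (at x)" "\<And>i. (\<lambda>y. H y $ i) differentiable (at x)"
  shows divergence_add: "divergence (\<lambda>y. G y + H y) x = divergence G x + divergence H x"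
    and divergence_diff: "divergence (\<lambda>y. G y - H y) x = divergence G x - divergence H x"
  using assms
  by (simp_all add: divergence_eq_grad grad_add grad_diff sum.distrib sum_subtractf)

subsection \<open>Integrals of divergences\<close>

text \<open>The difference quotients of \<open>f\<close> in direction \<open>e\<close> have integral 0 by translation invariance
  of Lebesgue measure, which avoids Fubini.\<close>

lemma integral_directional_derivative_eq_0:
  fixes f :: "real^'n \<Rightarrow> real" and g :: "real^'n \<Rightarrow> real^'n"
  assumes "compact K" and der: "\<And>x. (f has_derivative (\<lambda>h. g x \<bullet> h)) (at x)"
    and supp: "\<And>x. x \<notin> K \<Longrightarrow> f x = 0" and B: "\<And>x. norm (g x) \<le> B"
  shows "(\<integral>x. g x \<bullet> e \<partial>lborel) = 0"
proof -
  define h where "h n = inverse (real (Suc n))" for n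
  define s where "s n x = (f (h n *\<^sub>R e + x) - f x) / h n" for n x
  have h: "h n > 0" "h n \<le> 1" for n
    by (auto simp: h_def field_simps)
  have hlim: "h \<longlonglongrightarrow> 0"
    unfolding h_def by (rule LIMSEQ_inverse_real_of_nat)
  have cont: "continuous_on UNIV f"
    by (simp add: continuous_on_eq_continuous_within has_derivative_continuous[OF der])
  then have meas [measurable]: "f \<in> borel_measurable borel"
    by (rule borel_measurable_continuous_onI)
  have int: "integrable lborel f"
  proof -
    have "integrable lborel (\<lambda>x. indicator K x *\<^sub>R f x)"
      using \<open>compact K\<close> cont by (intro borel_integrable_compact) (auto intro: continuous_on_subset)
    also have "(\<lambda>x. indicator K x *\<^sub>R f x) = f"
      using supp by (auto simp: fun_eq_iff indicator_def)
    finally show ?thesis .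
  qed
  have shift: "integrable lborel (\<lambda>x. f (c + x))" "(\<integral>x. f (c + x) \<partial>lborel) = integral\<^sup>L lborel f" for c
  proof -
    have m: "(+) c \<in> lborel \<rightarrow>\<^sub>M borel" by simp
    show "integrable lborel (\<lambda>x. f (c + x))"
      using integrable_distr_eq[OF m meas] int by (simp add: lborel_distr_plus)
    show "(\<integral>x. f (c + x) \<partial>lborel) = integral\<^sup>L lborel f"
      using integral_distr[OF m meas] by (simp add: lborel_distr_plus)
  qed
  have s0: "integral\<^sup>L lborel (s n) = 0" for n
    using shift int by (simp add: s_def[abs_def])
  have lim: "(\<lambda>n. s n x) \<longlonglongrightarrow> g x \<bullet> e" for x
  proof -
    have "((\<lambda>t. f (t *\<^sub>R e + x)) has_derivative (\<lambda>t. g x \<bullet> (t *\<^sub>R e))) (at 0)"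
      by (rule has_derivative_compose[where g = f])
         (auto intro!: derivative_eq_intros simp: der)
    then have "((\<lambda>t. f (t *\<^sub>R e + x)) has_real_derivative g x \<bullet> e) (at 0)"
      unfolding has_field_derivative_def by (rule has_derivative_eq_rhs) (simp add: fun_eq_iff)
    then have "((\<lambda>t. (f (t *\<^sub>R e + x) - f x) / t) \<longlongrightarrow> g x \<bullet> e) (at 0)"
      by (simp add: DERIV_def)
    moreover have "filterlim h (at 0) sequentially"
      using hlim h by (auto simp: filterlim_at intro!: always_eventually less_imp_neq[symmetric])
    ultimately show ?thesis
      unfolding s_def by (rule filterlim_compose)
  qed
  obtain R where R: "\<And>x. x \<in> K \<Longrightarrow> norm x \<le> R"
    using compact_imp_bounded[OF \<open>compact K\<close>] by (auto simp: bounded_iff)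
  \<comment> \<open>An integrable majorant, uniform in \<open>n\<close>. The set \<open>K\<close>
    lies in the ball of radius \<open>R\<close> and the shifts have length at most
    \<open>norm e\<close>, so all difference quotients vanish outside the larger ball; inside it the
    mean value inequality bounds them by \<open>B * norm e\<close>.\<close>
  let ?w = "\<lambda>x. indicator (cball 0 (R + norm e)) x *\<^sub>R (B * norm e)"
  have bound: "norm (s n x) \<le> ?w x" for n x
  proof (cases "x \<in> cball 0 (R + norm e)")
    case True
    have "norm (f (h n *\<^sub>R e + x) - f x) \<le> B * norm (h n *\<^sub>R e + x - x)"
    proof (rule differentiable_bound[where S = UNIV])
      show "onorm (\<lambda>h. g x \<bullet> h) \<le> B" for x
      proof (rule onorm_bound)
        show "norm (g x \<bullet> y) \<le> B * norm y" for y
          using order_trans[OF Cauchy_Schwarz_ineq2 mult_right_mono[OF B]] by auto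
        show "0 \<le> B" using order_trans[OF norm_ge_zero B] .
      qed
    qed (use der in auto)
    then have "\<bar>f (h n *\<^sub>R e + x) - f x\<bar> \<le> (B * norm e) * h n"
      using h[of n] by (simp add: mult_ac)
    then show ?thesis
      using h[of n] True by (simp add: s_def field_simps)
  next
    case False
    have "norm (h n *\<^sub>R e) \<le> norm e"
      using h[of n] by (simp add: mult_left_le_one_le)
    then have "\<not> norm (h n *\<^sub>R e + x) \<le> R" 
      using False norm_triangle_ineq4[of "h n *\<^sub>R e + x" "h n *\<^sub>R e"] by auto
    moreover have "\<not> norm x \<le> R"
      using False by (auto simp: not_le) (use norm_ge_zero[of e] in linarith)
    ultimately have "f (h n *\<^sub>R e + x) = 0" "f x = 0"
      using R supp by blast+
    then show ?thesis using False by (simp add: s_def)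
  qed
  have "(\<lambda>n. integral\<^sup>L lborel (s n)) \<longlonglongrightarrow> (\<integral>x. g x \<bullet> e \<partial>lborel)"
  proof (rule integral_dominated_convergence)
    show sm: "s n \<in> borel_measurable lborel" for n
      unfolding s_def[abs_def] by measurable
    show "(\<lambda>x. g x \<bullet> e) \<in> borel_measurable lborel"
      by (rule borel_measurable_LIMSEQ_real[OF lim sm])
    show "integrable lborel ?w"
      by (rule borel_integrable_compact) auto
  qed (use lim bound in auto)
  then show ?thesis
    by (simp add: s0 LIMSEQ_const_iff)
qed

text \<open>The divergence is a sum of derivatives of components along the axes, and each of these
  integrates to 0 by \<open>integral_directional_derivative_eq_0\<close>, once the component is
  extended to the whole space.\<close>

lemma integral_divergence_compact_support:
  fixes G :: "real^'n \<Rightarrow> real^'n"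
  assumes "open S" "compact K" "K \<subseteq> S" and G: "\<And>i. C1_on (\<lambda>x. G x $ i) S"
    and supp: "\<And>x. x \<in> S - K \<Longrightarrow> G x = 0"
  shows "set_integrable lborel K (divergence G)" "(LINT x:K|lborel. divergence G x) = 0"
proof -
  have contK: "continuous_on K (grad (\<lambda>x. G x $ i))" for i
    using C1_onD(3)[OF G] \<open>K \<subseteq> S\<close> continuous_on_subset by blast
  have int: "set_integrable lborel K (\<lambda>x. grad (\<lambda>y. G y $ i) x $ i)" for i
    unfolding set_integrable_def
    using contK by (intro borel_integrable_compact \<open>compact K\<close> continuous_intros)
  have split: "(\<lambda>x. indicator K x *\<^sub>R divergence G x)
      = (\<lambda>x. \<Sum>i\<in>UNIV. indicator K x *\<^sub>R grad (\<lambda>y. G y $ i) x $ i)"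
    by (simp only: divergence_eq_grad scaleR_sum_right)
  from int show "set_integrable lborel K (divergence G)"
    unfolding set_integrable_def split by (intro Bochner_Integration.integrable_sum)
  have zero: "(LINT x:K|lborel. grad (\<lambda>y. G y $ i) x $ i) = 0" for i
  proof -
    \<comment> \<open>Extension by zero. Near a point of \<open>K\<close> it agrees with the
      component of \<open>G\<close>, which vanishes on \<open>S - K\<close>; off \<open>K\<close> it
      vanishes locally because \<open>K\<close> is closed.\<close>
    let ?f = "\<lambda>x. if x \<in> K then G x $ i else 0"
    let ?g = "\<lambda>x. indicator K x *\<^sub>R grad (\<lambda>y. G y $ i) x"
    have der: "(?f has_derivative (\<lambda>h. ?g x \<bullet> h)) (at x)" for x
    proof (cases "x \<in> K")
      case True
      then have "x \<in> S" using \<open>K \<subseteq> S\<close> by auto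
      have "((\<lambda>y. G y $ i) has_derivative (\<lambda>h. ?g x \<bullet> h)) (at x)"
        using C1_onD(2)[OF G \<open>x \<in> S\<close>] True by simp
      then show ?thesis
        by (rule has_derivative_transform_within_open[OF _ \<open>open S\<close> \<open>x \<in> S\<close>]) (use supp in auto)
    next
      case False
      have "((\<lambda>y. 0) has_derivative (\<lambda>h. ?g x \<bullet> h)) (at x)"
        using False by simp
      then show ?thesis
        by (rule has_derivative_transform_within_open[where s = "- K"])
           (use False \<open>compact K\<close> in \<open>auto intro: compact_imp_closed\<close>)
    qed
    have "compact ((\<lambda>x. norm (grad (\<lambda>y. G y $ i) x)) ` K)"
      using contK by (intro compact_continuous_image continuous_intros \<open>compact K\<close>)
    then obtain B where B: "\<And>x. x \<in> K \<Longrightarrow> norm (grad (\<lambda>y. G y $ i) x) \<le> B"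
      using bounded_imp_bdd_above[OF compact_imp_bounded] by (force simp: bdd_above_def)
    have "norm (?g x) \<le> max 0 B" for x
      using B by (auto simp: indicator_def le_max_iff_disj)
    from integral_directional_derivative_eq_0[OF \<open>compact K\<close> der _ this, of "axis i 1"]
    show ?thesis
      by (simp add: set_lebesgue_integral_def inner_axis)
  qed
  show "(LINT x:K|lborel. divergence G x) = 0"
    using int zero unfolding set_lebesgue_integral_def split set_integrable_def
    by (subst Bochner_Integration.integral_sum) auto
qed

section \<open>Positive integrals from positivity at one point\<close>

lemma set_integral_ge_ball:
  fixes f :: "'a::euclidean_space \<Rightarrow> real"
  assumes f: "set_integrable lborel K f" and nonneg: "\<And>x. x \<in> K \<Longrightarrow> 0 \<le> f x"
    and "cball z \<rho> \<subseteq> K" "0 \<le> c" "\<And>x. x \<in> cball z \<rho> \<Longrightarrow> c \<le> f x"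
  shows "c * measure lborel (cball z \<rho>) \<le> (LINT x:K|lborel. f x)"
proof -
  have "c * measure lborel (cball z \<rho>) = (\<integral>x. indicator (cball z \<rho>) x *\<^sub>R c \<partial>lborel)"
    by simp
  also have "\<dots> \<le> (LINT x:K|lborel. f x)"
    unfolding set_lebesgue_integral_def
  proof (rule integral_mono)
    show "integrable lborel (\<lambda>x. indicator (cball z \<rho>) x *\<^sub>R c)"
      by (rule borel_integrable_compact) auto
  qed (use assms in \<open>auto simp: set_integrable_def indicator_def\<close>)
  finally show ?thesis .
qed

lemma open_strict_superlevel_set:
  fixes f :: "'a::topological_space \<Rightarrow> real"
  assumes "open S" "continuous_on S f"
  shows "open {x \<in> S. c < f x}"
  using continuous_on_open_vimage[OF \<open>open S\<close>, of f] assms(2)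
  by (auto simp: Collect_conj_eq Int_commute vimage_def dest!: spec[of _ "{c<..}"])

lemma continuous_pos_cball:
  fixes f :: "'a::heine_borel \<Rightarrow> real"
  assumes "open S" "continuous_on S f" "z \<in> S" "f z > 0"
  obtains \<rho> where "\<rho> > 0" "cball z \<rho> \<subseteq> S" "\<forall>x\<in>cball z \<rho>. f z / 2 \<le> f x"
proof -
  have "open {x \<in> S. f x > f z / 2}"
    using assms(1,2) by (rule open_strict_superlevel_set)
  moreover have "z \<in> {x \<in> S. f x > f z / 2}" using assms by simp
  ultimately obtain \<rho> where "\<rho> > 0" "cball z \<rho> \<subseteq> {x \<in> S. f x > f z / 2}"
    by (meson open_contains_cball)
  then show thesis by (intro that[of \<rho>]) (auto intro: less_imp_le)
qed

subsection \<open>Cutoff functions around Hausdorff null sets\<close>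

text \<open>A cover of \<open>A\<close> by small pieces with small total weight exists by nullity.
  Each piece meeting \<open>K\<close> lies in an open ball centred at one of its points in
  \<open>K\<close>, of radius slightly larger than its diameter, and compactness leaves finitely
  many balls.\<close>

lemma hausdorff_null_finite_cover:
  fixes A K :: "'a::metric_space set"
  assumes null: "hausdorff_measure k A = 0" and "compact K" "K \<subseteq> A" "0 < \<eta>" "0 < \<delta>"
  obtains I :: "nat set" and c r where "finite I" "\<forall>i\<in>I. c i \<in> K"
    "\<forall>i\<in>I. 0 < r i \<and> r i < \<delta>" "K \<subseteq> (\<Union>i\<in>I. ball (c i) (r i))" "(\<Sum>i\<in>I. r i ^ k) < \<eta>"
proof -
  \<comment> \<open>The constant with \<open>hausdorff_weight k U = b * diameter U ^ k\<close> for
    nonempty \<open>U\<close>.\<close>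
  define b where "b = unit_ball_vol (real k) / 2 ^ k"
  have "b > 0" by (simp add: b_def)
  have "hausdorff_premeasure k (\<delta> / 2) A \<le> hausdorff_measure k A"
    unfolding hausdorff_measure_def using \<open>0 < \<delta>\<close> by (intro SUP_upper) auto
  also have "\<dots> < ennreal (b * \<eta> / 2)"
    using null \<open>b > 0\<close> \<open>\<eta> > 0\<close> by (simp add: ennreal_zero_less_mult_iff)
  finally obtain U :: "nat \<Rightarrow> 'a set" where U: "A \<subseteq> (\<Union>i. U i)" "\<And>i. bounded (U i)"
    "\<And>i. diameter (U i) \<le> \<delta> / 2" "(\<Sum>i. hausdorff_weight k (U i)) < ennreal (b * \<eta> / 2)"
    unfolding hausdorff_premeasure_def INF_less_iff by auto
  \<comment> \<open>Strict enlargement makes the radius positive and the ball open around the piece.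
    The excess in the \<open>k\<close>-th powers is charged to a geometric series of total \<eta>/2;
    the other half of \<eta> pays for the diameters.\<close>
  have "\<exists>r>diameter (U i). r < \<delta> \<and> r ^ k < diameter (U i) ^ k + \<eta> / 2 * (1 / 2) ^ Suc i" for i
  proof -
    let ?d = "diameter (U i)"
    have "((\<lambda>r. r ^ k) \<longlongrightarrow> ?d ^ k) (at_right ?d)"
      by (intro tendsto_intros)
    then have "\<forall>\<^sub>F r in at_right ?d. r ^ k < ?d ^ k + \<eta> / 2 * (1 / 2) ^ Suc i"
      using \<open>\<eta> > 0\<close> by (intro order_tendstoD(2)) auto
    moreover have "\<forall>\<^sub>F r in at_right ?d. r < \<delta>"
      using U(3)[of i] \<open>\<delta> > 0\<close> by (intro order_tendstoD(2)[OF tendsto_ident_at]) auto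
    moreover have "\<forall>\<^sub>F r in at_right ?d. ?d < r"
      by (rule eventually_at_right_less)
    ultimately have "\<forall>\<^sub>F r in at_right ?d.
        ?d < r \<and> r < \<delta> \<and> r ^ k < ?d ^ k + \<eta> / 2 * (1 / 2) ^ Suc i"
      by eventually_elim simp
    from eventually_happens'[OF trivial_limit_at_right_real this] show ?thesis by blast
  qed
  then obtain r where r: "\<And>i. diameter (U i) < r i" "\<And>i. r i < \<delta>"
    "\<And>i. r i ^ k < diameter (U i) ^ k + \<eta> / 2 * (1 / 2) ^ Suc i"
    by metis
  \<comment> \<open>Only pieces meeting \<open>K\<close> are kept: their centres can be taken in
    \<open>K\<close>, and being nonempty they carry the full weight.\<close>
  define J where "J = {i. U i \<inter> K \<noteq> {}}"
  define c where "c i = (SOME x. x \<in> U i \<inter> K)" for i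
  have c: "c i \<in> U i" "c i \<in> K" if "i \<in> J" for i
    using that someI_ex[of "\<lambda>x. x \<in> U i \<inter> K"] by (auto simp: J_def c_def)
  have "K \<subseteq> (\<Union>i\<in>J. ball (c i) (r i))"
  proof
    fix x assume "x \<in> K"
    moreover from this obtain i where "x \<in> U i"
      using U(1) \<open>K \<subseteq> A\<close> by blast
    ultimately have i: "x \<in> U i" "i \<in> J"
      by (auto simp: J_def)
    have "dist (c i) x \<le> diameter (U i)"
      using diameter_bounded_bound[OF U(2)] c i by blast
    then show "x \<in> (\<Union>i\<in>J. ball (c i) (r i))"
      using r(1)[of i] i by (auto intro!: bexI[of _ i])
  qed
  then obtain I where I: "I \<subseteq> J" "finite I" "K \<subseteq> (\<Union>i\<in>I. ball (c i) (r i))"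
    using compactE_image[OF \<open>compact K\<close>, of J "\<lambda>i. ball (c i) (r i)"] by auto
  have nonneg: "diameter (U i) \<ge> 0" for i
    using U(2) by (rule diameter_ge_0)
  have "ennreal (b * (\<Sum>i\<in>I. diameter (U i) ^ k)) = (\<Sum>i\<in>I. hausdorff_weight k (U i))"
  proof -
    have "hausdorff_weight k (U i) = ennreal (b * diameter (U i) ^ k)" if "i \<in> I" for i
      using c(1) that I(1) by (auto simp: hausdorff_weight_def b_def power_divide)
    then show ?thesis
      using nonneg \<open>b > 0\<close> by (simp add: sum_distrib_left sum_ennreal)
  qed
  also have "\<dots> \<le> (\<Sum>i. hausdorff_weight k (U i))"
    using \<open>finite I\<close> by (intro sum_le_suminf) auto
  also note U(4)
  finally have "b * (\<Sum>i\<in>I. diameter (U i) ^ k) < b * (\<eta> / 2)"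
    using nonneg \<open>b > 0\<close> by (subst (asm) ennreal_less_iff) (auto intro!: mult_nonneg_nonneg sum_nonneg)
  then have small: "(\<Sum>i\<in>I. diameter (U i) ^ k) < \<eta> / 2"
    using \<open>b > 0\<close> by simp
  have "(\<Sum>i\<in>I. (1 / 2 :: real) ^ Suc i) \<le> 1"
    using sum_le_suminf[of "\<lambda>i. (1 / 2 :: real) ^ Suc i" I] power_half_series \<open>finite I\<close>
    by (auto simp: sums_iff)
  then have geo: "(\<Sum>i\<in>I. \<eta> / 2 * (1 / 2) ^ Suc i) \<le> \<eta> / 2"
    using \<open>\<eta> > 0\<close> unfolding sum_distrib_left[symmetric] by (simp add: mult_left_le)
  have "(\<Sum>i\<in>I. r i ^ k) \<le> (\<Sum>i\<in>I. diameter (U i) ^ k + \<eta> / 2 * (1 / 2) ^ Suc i)"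
    by (intro sum_mono less_imp_le r)
  also have "\<dots> < \<eta>"
    using small geo by (simp add: sum.distrib)
  finally have sum: "(\<Sum>i\<in>I. r i ^ k) < \<eta>" .
  show thesis
  proof (rule that[of I c r])
    show "\<forall>i\<in>I. 0 < r i \<and> r i < \<delta>"
      using le_less_trans[OF nonneg r(1)] r(2) by blast
  qed (use I c sum in auto)
qed

section \<open>Truncation and bump functions\<close>

definition sqpos :: "real \<Rightarrow> real" where
  "sqpos t = (max 0 t)\<^sup>2"

lemma sqpos_nonneg: "0 \<le> sqpos t"
  by (simp add: sqpos_def)

text \<open>Squaring removes the kink of the positive part: at 0 the difference quotient is bounded
  by \<open>\<bar>h\<bar>\<close>. The derivative is continuous, so \<open>sqpos\<close> may be used
  in \<open>C1_on\<close> test functions.\<close>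

lemma has_real_derivative_sqpos: "(sqpos has_real_derivative 2 * max 0 t) (at t)"
proof (cases "t = 0")
  case True
  have "((\<lambda>h::real. max 0 h * (max 0 h / h)) \<longlongrightarrow> 0) (at 0)"
  proof (rule Lim_null_comparison)
    show "\<forall>\<^sub>F h::real in at 0. norm (max 0 h * (max 0 h / h)) \<le> \<bar>h\<bar>"
      by (rule always_eventually) (auto simp: max_def)
  qed (auto intro!: tendsto_eq_intros)
  then have "((\<lambda>h. sqpos h / h) \<longlongrightarrow> 0) (at 0)"
    by (simp add: sqpos_def power2_eq_square)
  then show ?thesis
    using True by (simp add: DERIV_def sqpos_def)
next
  case False
  then consider "t > 0" | "t < 0" by linarith
  then show ?thesis
  proof cases
    case 1
    have "((\<lambda>t. t\<^sup>2) has_real_derivative 2 * max 0 t) (at t)"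
      using 1 by (auto intro!: derivative_eq_intros)
    then show ?thesis
      by (rule has_field_derivative_transform_within_open[of _ _ _ "{0<..}"])
         (use 1 in \<open>auto simp: sqpos_def\<close>)
  next
    case 2
    have "((\<lambda>t. 0) has_real_derivative 2 * max 0 t) (at t)"
      using 2 by simp
    then show ?thesis
      by (rule has_field_derivative_transform_within_open[of _ _ _ "{..<0}"])
         (use 2 in \<open>auto simp: sqpos_def\<close>)
  qed
qed

lemma C1_on_sqpos: "C1_on f S \<Longrightarrow> C1_on (\<lambda>x. sqpos (f x)) S"
  by (rule C1_on_compose[where g' = "\<lambda>t. 2 * max 0 t"])
     (auto intro!: continuous_intros has_real_derivative_sqpos)

lemma grad_sqpos:
  "f differentiable (at x) \<Longrightarrow> grad (\<lambda>x. sqpos (f x)) x = (2 * max 0 (f x)) *\<^sub>R grad f x"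
  by (rule grad_compose[OF _ has_real_derivative_sqpos])

text \<open>On the ball of radius \<open>r\<close> the argument of \<open>sqpos\<close> is at least
  3, and division by 9 makes the value at least 1; beyond distance \<open>2 * r\<close> the argument
  is negative.\<close>

definition bump :: "real^'n \<Rightarrow> real \<Rightarrow> real^'n \<Rightarrow> real" where
  "bump c r x = sqpos (4 - (norm (x - c))\<^sup>2 / r\<^sup>2) / 9"

lemma has_derivative_bump:
  "(bump c r has_derivative
     (\<lambda>h. (- (4 * max 0 (4 - (norm (x - c))\<^sup>2 / r\<^sup>2) / 9 / r\<^sup>2)) *\<^sub>R (x - c) \<bullet> h)) (at x)"
proof -
  have "((\<lambda>x. 4 - (norm (x - c))\<^sup>2 / r\<^sup>2) has_derivative (\<lambda>h. - (2 * ((x - c) \<bullet> h) / r\<^sup>2))) (at x)"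
    unfolding power2_norm_eq_inner
    by (auto intro!: derivative_eq_intros simp: inner_commute divide_inverse algebra_simps)
  from has_derivative_compose[OF this has_real_derivative_sqpos[unfolded has_field_derivative_def]]
  have "((\<lambda>x. sqpos (4 - (norm (x - c))\<^sup>2 / r\<^sup>2) / 9) has_derivative
    (\<lambda>h. 2 * max 0 (4 - (norm (x - c))\<^sup>2 / r\<^sup>2) * - (2 * ((x - c) \<bullet> h) / r\<^sup>2) / 9)) (at x)"
    by (rule bounded_linear.has_derivative[OF bounded_linear_divide])
  moreover have "2 * M * - (2 * ((x - c) \<bullet> h) / r\<^sup>2) / 9 = (- (4 * M / 9 / r\<^sup>2)) *\<^sub>R (x - c) \<bullet> h" for M h
    unfolding inner_scaleR_left by (simp add: field_simps)
  ultimately show ?thesis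
    unfolding bump_def[abs_def] by (simp only:)
qed

lemma C1_on_bump: "C1_on (bump c r) S"
  by (rule C1_onI[OF has_derivative_bump])
     (unfold divide_inverse, intro continuous_intros)

lemma bump_nonneg: "0 \<le> bump c r x"
  by (simp add: bump_def sqpos_nonneg)

lemma bump_ge_1:
  assumes "x \<in> ball c r"
  shows "1 \<le> bump c r x"
proof -
  have "norm (x - c) < r" using assms by (simp add: dist_norm norm_minus_commute)
  then have "(norm (x - c))\<^sup>2 / r\<^sup>2 \<le> 1"
    by (auto simp: divide_le_eq_1 intro!: power_mono)
  then have "3\<^sup>2 \<le> (max 0 (4 - (norm (x - c))\<^sup>2 / r\<^sup>2))\<^sup>2"
    by (intro power_mono) auto
  then show ?thesis by (simp add: bump_def sqpos_def)
qed

lemma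
  assumes "0 < r" "x \<notin> cball c (2 * r)"
  shows bump_eq_0: "bump c r x = 0" and grad_bump_eq_0: "grad (bump c r) x = 0"
proof -
  have "norm (x - c) > 2 * r"
    using assms by (simp add: dist_norm norm_minus_commute)
  then have "(2 * r)\<^sup>2 \<le> (norm (x - c))\<^sup>2"
    using assms by (intro power_mono) auto
  then have "4 - (norm (x - c))\<^sup>2 / r\<^sup>2 \<le> 0"
    using assms by (simp add: field_simps)
  then show "bump c r x = 0" "grad (bump c r) x = 0"
    by (auto simp: bump_def sqpos_def grad_eqI[OF has_derivative_bump] max_def)
qed

text \<open>The gradient is at most 32/(9 r) on a ball of radius \<open>2 * r\<close>. The integral
  of this bound scales like the power of \<open>r\<close> with exponent one below the dimension,
  exactly the weight of the ball in the Hausdorff measure of codimension 1.\<close>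

lemma norm_grad_bump_le:
  assumes "0 < r"
  shows "norm (grad (bump c r) x) \<le> 4 / r * indicator (cball c (2 * r)) x"
proof (cases "x \<in> cball c (2 * r)")
  case True
  then have le: "norm (x - c) \<le> 2 * r"
    by (simp add: dist_norm norm_minus_commute)
  have "norm (grad (bump c r) x)
      = 4 * max 0 (4 - (norm (x - c))\<^sup>2 / r\<^sup>2) / 9 / r\<^sup>2 * norm (x - c)"
    by (simp add: grad_eqI[OF has_derivative_bump] abs_mult)
  also have "\<dots> \<le> 4 * 4 / 9 / r\<^sup>2 * (2 * r)"
    using le by (intro mult_mono divide_right_mono mult_left_mono) auto
  also have "\<dots> \<le> 4 / r"
    using assms by (simp add: power2_eq_square field_simps)
  finally show ?thesis using True by simp
next
  case False
  then show ?thesis using assms by (simp add: grad_bump_eq_0)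
qed

text \<open>For a finite cover of \<open>K\<close> by balls, let \<sigma> be the sum of their bumps
  and \<psi> the squared positive part of 1 - \<sigma>. On the cover \<sigma> is at least 1, so
  \<psi> vanishes; away from \<open>K\<close> all bumps vanish, so \<psi> is 1. The gradient of
  \<psi> is at most twice the sum of the bump gradients, whose integral is controlled by the weights
  of the balls.\<close>

lemma hausdorff_null_cutoff:
  fixes A K :: "(real^'n) set"
  assumes null: "hausdorff_measure (CARD('n) - 1) A = 0" and "compact K" "K \<subseteq> A" "0 < \<eta>" "0 < \<delta>"
  obtains \<psi> g :: "real^'n \<Rightarrow> real" and U where "C1_on \<psi> UNIV" "\<forall>x. 0 \<le> \<psi> x"
    "open U" "K \<subseteq> U" "\<forall>x\<in>U. \<psi> x = 0"
    "\<forall>x. (\<forall>y\<in>K. dist y x > \<delta>) \<longrightarrow> \<psi> x = 1"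
    "\<forall>x. norm (grad \<psi> x) \<le> g x" "\<forall>x. 0 \<le> g x" "integrable lborel g" "integral\<^sup>L lborel g < \<eta>"
proof -
  define m where "m = CARD('n)"
  define V where "V = unit_ball_vol (real m)"
  have "m > 0" by (simp add: m_def)
  have "V > 0" by (simp add: V_def)
  \<comment> \<open>The integral of \<open>8 / r\<close> over a ball of radius \<open>2 * r\<close>
    equals \<open>C * r ^ (m - 1)\<close>.\<close>
  define C where "C = 8 * V * 2 ^ m"
  have "C > 0" using \<open>V > 0\<close> by (simp add: C_def)
  \<comment> \<open>Radii below \<delta>/2 are requested because each bump lives on the ball of
    twice the radius.\<close>
  obtain I :: "nat set" and c r where I: "finite I" "\<forall>i\<in>I. c i \<in> K"
    "\<forall>i\<in>I. 0 < r i \<and> r i < \<delta> / 2" "K \<subseteq> (\<Union>i\<in>I. ball (c i) (r i))"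
    "(\<Sum>i\<in>I. r i ^ (m - 1)) < \<eta> / C"
    by (rule hausdorff_null_finite_cover[OF null \<open>compact K\<close> \<open>K \<subseteq> A\<close>
          divide_pos_pos[OF \<open>0 < \<eta>\<close> \<open>0 < C\<close>] half_gt_zero[OF \<open>0 < \<delta>\<close>], folded m_def]) (rule that)
  define \<sigma> where "\<sigma> x = (\<Sum>i\<in>I. bump (c i) (r i) x)" for x
  define \<psi> where "\<psi> x = sqpos (1 - \<sigma> x)" for x
  define g where "g x = (\<Sum>i\<in>I. 8 / r i * indicator (cball (c i) (2 * r i)) x)" for x
  have \<sigma>_C1: "C1_on \<sigma> UNIV"
    unfolding \<sigma>_def[abs_def] by (intro C1_on_sum C1_on_bump)
  have \<sigma>_nonneg: "0 \<le> \<sigma> x" for x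
    unfolding \<sigma>_def by (intro sum_nonneg bump_nonneg)
  have 1: "C1_on \<psi> UNIV"
    unfolding \<psi>_def[abs_def] by (intro C1_on_sqpos C1_on_diff C1_on_const \<sigma>_C1)
  have 2: "\<psi> x = 0" if x: "x \<in> (\<Union>i\<in>I. ball (c i) (r i))" for x
  proof -
    obtain i where i: "i \<in> I" "x \<in> ball (c i) (r i)" using x by auto
    have "1 \<le> bump (c i) (r i) x" using i by (intro bump_ge_1)
    also have "\<dots> \<le> \<sigma> x"
      unfolding \<sigma>_def using i I(1) by (intro member_le_sum bump_nonneg) auto
    finally show ?thesis by (simp add: \<psi>_def sqpos_def)
  qed
  have 3: "\<psi> x = 1" if far: "\<And>y. y \<in> K \<Longrightarrow> dist y x > \<delta>" for x
  proof -
    have "bump (c i) (r i) x = 0" if "i \<in> I" for i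
      using far[of "c i"] I(2,3) that by (intro bump_eq_0) auto
    then show ?thesis by (simp add: \<psi>_def \<sigma>_def sqpos_def)
  qed
  have 4: "norm (grad \<psi> x) \<le> g x" for x
  proof -
    have diff: "bump (c i) (r i) differentiable (at x)" "\<sigma> differentiable (at x)" for i
      using C1_onD(1)[OF C1_on_bump, of x UNIV] C1_onD(1)[OF \<sigma>_C1] by auto
    have "grad \<psi> x = (2 * max 0 (1 - \<sigma> x)) *\<^sub>R (- grad \<sigma> x)"
      unfolding \<psi>_def[abs_def] using diff by (simp add: grad_sqpos grad_diff)
    also have "grad \<sigma> x = (\<Sum>i\<in>I. grad (bump (c i) (r i)) x)"
      unfolding \<sigma>_def[abs_def] using diff(1) by (rule grad_sum)
    finally have "norm (grad \<psi> x) = 2 * max 0 (1 - \<sigma> x) * norm (\<Sum>i\<in>I. grad (bump (c i) (r i)) x)"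
      by simp
    also have "\<dots> \<le> 2 * 1 * (\<Sum>i\<in>I. norm (grad (bump (c i) (r i)) x))"
      using \<sigma>_nonneg[of x] by (intro mult_mono norm_sum) auto
    also have "\<dots> \<le> 2 * 1 * (\<Sum>i\<in>I. 4 / r i * indicator (cball (c i) (2 * r i)) x)"
      using I(3) by (intro mult_left_mono sum_mono norm_grad_bump_le) auto
    also have "\<dots> = g x" by (simp add: g_def sum_distrib_left mult.assoc)
    finally show ?thesis .
  qed
  have int: "integrable lborel (\<lambda>x. 8 / r i * indicator (cball (c i) (2 * r i)) x)" for i
    using emeasure_compact_finite[OF compact_cball]
    by (intro integrable_mult_right integrable_real_indicator) auto
  then have 5: "integrable lborel g" unfolding g_def[abs_def] by auto
  have "integral\<^sup>L lborel g = (\<Sum>i\<in>I. 8 / r i * measure lborel (cball (c i) (2 * r i)))"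
    unfolding g_def[abs_def] using int by (subst Bochner_Integration.integral_sum) auto
  also have "\<dots> = (\<Sum>i\<in>I. C * r i ^ (m - 1))"
  proof (rule sum.cong)
    fix i assume "i \<in> I"
    then have "r i > 0" using I(3) by auto
    moreover have "r i ^ m = r i * r i ^ (m - 1)"
      using \<open>m > 0\<close> by (simp add: power_eq_if)
    ultimately show "8 / r i * measure lborel (cball (c i) (2 * r i)) = C * r i ^ (m - 1)"
      by (simp add: content_cball C_def V_def m_def power_mult_distrib)
  qed simp
  also have "\<dots> < \<eta>"
    using I(5) \<open>C > 0\<close> by (simp add: sum_distrib_left[symmetric] field_simps)
  finally have 6: "integral\<^sup>L lborel g < \<eta>" .
  show thesis
  proof (rule that[OF 1 _ _ I(4) _ _ _ _ 5 6])
    show "\<forall>x. 0 \<le> g x" using order_trans[OF norm_ge_zero 4] by blast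
    show "\<forall>x. (\<forall>y\<in>K. dist y x > \<delta>) \<longrightarrow> \<psi> x = 1" using 3 by blast
  qed (use 2 4 in \<open>auto simp: \<psi>_def sqpos_nonneg\<close>)
qed

subsection \<open>The comparison principle\<close>

lemma C1_on_sgn:
  fixes A :: "real^'n \<Rightarrow> real^'n"
  assumes A: "\<And>i. C1_on (\<lambda>x. A x $ i) S" and nz: "\<And>x. x \<in> S \<Longrightarrow> A x \<noteq> 0"
  shows "C1_on (\<lambda>x. sgn (A x) $ i) S"
proof -
  let ?q = "\<lambda>x. \<Sum>i\<in>UNIV. A x $ i * A x $ i"
  have q: "?q x = A x \<bullet> A x" for x by (simp add: inner_vec_def)
  have "C1_on (\<lambda>x. inverse (sqrt (?q x))) S"
  proof (rule C1_on_compose[where f = ?q and g = "\<lambda>t. inverse (sqrt t)" and g' = "\<lambda>t. - (inverse (sqrt t) * (inverse (sqrt t) / 2) * inverse (sqrt t))"])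
    show "C1_on ?q S" by (intro C1_on_sum C1_on_mult A)
    fix x assume "x \<in> S"
    then have "?q x > 0" using nz unfolding q by simp
    then show "((\<lambda>t. inverse (sqrt t)) has_real_derivative
        - (inverse (sqrt (?q x)) * (inverse (sqrt (?q x)) / 2) * inverse (sqrt (?q x)))) (at (?q x))"
      by (intro DERIV_inverse' DERIV_real_sqrt) auto
  next
    have pos: "t \<noteq> 0" if "t \<in> ?q ` S" for t using that nz unfolding q by auto
    show "continuous_on (?q ` S) (\<lambda>t. - (inverse (sqrt t) * (inverse (sqrt t) / 2) * inverse (sqrt t)))"
      by (intro continuous_intros ballI) (simp_all add: pos)
  qed
  then have "C1_on (\<lambda>x. inverse (sqrt (?q x)) * A x $ i) S"
    by (rule C1_on_mult[OF _ A])
  also have "(\<lambda>x. inverse (sqrt (?q x)) * A x $ i) = (\<lambda>x. sgn (A x) $ i)"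
    unfolding q by (simp add: sgn_div_norm norm_eq_sqrt_inner)
  finally show ?thesis .
qed

text \<open>With \<open>s = sgn p \<bullet> sgn q\<close>, both sides equal
  \<open>(norm p + norm q) * (1 - s)\<close>. Hence the left side is nonnegative and vanishes only
  when the unit vectors agree.\<close>

lemma inner_diff_sgn:
  fixes p q :: "'a::real_inner"
  assumes "p \<noteq> 0" "q \<noteq> 0"
  shows "(p - q) \<bullet> (sgn p - sgn q) = (norm p + norm q) / 2 * (norm (sgn p - sgn q))\<^sup>2"
proof -
  have p: "p \<bullet> x = norm p * (sgn p \<bullet> x)" for x
    using assms by (simp add: sgn_div_norm)
  have q: "q \<bullet> x = norm q * (sgn q \<bullet> x)" for x
    using assms by (simp add: sgn_div_norm)
  have "sgn p \<bullet> sgn p = 1" "sgn q \<bullet> sgn q = 1"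
    using assms by (simp_all add: norm_sgn flip: power2_norm_eq_inner)
  then show ?thesis
    unfolding power2_norm_eq_inner inner_diff_left inner_diff_right p q
    by (simp add: inner_commute[of "sgn q" "sgn p"] field_simps)
qed

text \<open>The quadratic forms of \<open>a\<close> and of its transpose coincide, while skewness
  makes them opposite.\<close>

lemma skew_matrix_inner_eq_0:
  fixes a :: "real^'n^'n"
  assumes "\<And>j k. a $ j $ k + a $ k $ j = 0"
  shows "(a *v y) \<bullet> y = 0"
proof -
  have "transpose a + a = 0"
    using assms by (simp add: transpose_def vec_eq_iff)
  then have "transpose a *v y + a *v y = 0"
    by (metis matrix_vector_mult_add_rdistrib matrix_vector_mult_0)
  then have "(transpose a *v y) \<bullet> y + (a *v y) \<bullet> y = 0"
    by (metis inner_add_left inner_zero_left)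
  then show ?thesis
    using dot_lmul_matrix[of y a y] by (simp add: inner_commute)
qed

lemma divergence_matrix_mult:
  fixes a :: "real^'n^'n"
  assumes "\<And>k. (\<lambda>y. G y $ k) differentiable (at x)"
  shows "divergence (\<lambda>y. a *v G y) x = (\<Sum>i\<in>UNIV. \<Sum>k\<in>UNIV. a $ i $ k * grad (\<lambda>y. G y $ k) x $ i)"
  using assms
  by (simp add: divergence_eq_grad matrix_vector_mult_def grad_sum grad_cmult)

text \<open>The divergence is the contraction of the skew matrix \<open>a\<close> with the symmetric
  Hessian of \<open>u\<close>; exchanging the two indices changes its sign.\<close>

lemma divergence_skew_grad_eq_0:
  fixes a :: "real^'n^'n" and u :: "real^'n \<Rightarrow> real"
  assumes skew: "\<And>j k. a $ j $ k + a $ k $ j = 0" and "open S" "x \<in> S" and u: "Ck_on 2 u S"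
  shows "divergence (\<lambda>y. a *v grad u y) x = 0"
proof -
  let ?H = "\<lambda>i k. grad (\<lambda>y. grad u y $ k) x $ i"
  have sym: "?H i k = ?H k i" for i k
    using second_derivative_symmetric[OF \<open>open S\<close> \<open>x \<in> S\<close> Ck_on_2_C1_on[OF u], of "axis k 1" "axis i 1"]
      Ck_on_2_grad[OF u] by (simp add: inner_axis)
  have "divergence (\<lambda>y. a *v grad u y) x = (\<Sum>i\<in>UNIV. \<Sum>k\<in>UNIV. a $ i $ k * ?H i k)"
    using C1_onD(1)[OF Ck_on_2_grad[OF u] \<open>x \<in> S\<close>] by (rule divergence_matrix_mult)
  moreover have "(\<Sum>i\<in>UNIV. \<Sum>k\<in>UNIV. a $ i $ k * ?H i k)
      = - (\<Sum>i\<in>UNIV. \<Sum>k\<in>UNIV. a $ k $ i * ?H i k)"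
    unfolding sum_negf[symmetric]
    by (intro sum.cong refl) (simp add: eq_neg_iff_add_eq_0 skew flip: distrib_right)
  moreover have "(\<Sum>i\<in>UNIV. \<Sum>k\<in>UNIV. a $ k $ i * ?H i k) = (\<Sum>i\<in>UNIV. \<Sum>k\<in>UNIV. a $ i $ k * ?H i k)"
    by (rule trans[OF sum.swap]) (intro sum.cong refl arg_cong2[where f = "(*)"] sym)
  ultimately show ?thesis by linarith
qed

lemma C1_on_matrix_mult:
  fixes a :: "real^'n^'n"
  assumes "\<And>k. C1_on (\<lambda>x. G x $ k) S"
  shows "C1_on (\<lambda>x. (a *v G x) $ i) S"
  using assms by (simp add: matrix_vector_mult_def C1_on_sum C1_on_mult C1_on_const)

lemma continuous_on_divergence:
  assumes "\<And>i. C1_on (\<lambda>x. G x $ i) S"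
  shows "continuous_on S (divergence G)"
  unfolding divergence_eq_grad[abs_def]
  using C1_onD(3)[OF assms] by (intro continuous_intros)

lemma continuous_on_vec_components:
  fixes G :: "'a::topological_space \<Rightarrow> real^'n"
  assumes "\<And>i. continuous_on S (\<lambda>x. G x $ i)"
  shows "continuous_on S G"
  using continuous_on_vec_lambda[of S "\<lambda>i x. G x $ i"] assms by simp

text \<open>The strict bound on the frontier means that passing to \<open>closure S\<close> adds no
  points, so the set is closed as well as bounded.\<close>

lemma compact_superlevel_set:
  fixes f :: "'a::heine_borel \<Rightarrow> real"
  assumes "bounded S" "continuous_on (closure S) f" "\<And>x. x \<in> frontier S \<Longrightarrow> f x < c"
  shows "compact {x \<in> S. c \<le> f x}"
proof -
  have "closure S = S \<union> frontier S"
    by (simp add: frontier_def closure_def) (use interior_subset in blast)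
  then have "{x \<in> S. c \<le> f x} = closure S \<inter> f -` {c..}"
    using assms(3) closure_subset[of S] by (force simp: not_le)
  moreover have "closed (closure S \<inter> f -` {c..})"
    using assms(2) closed_closure closed_atLeast by (rule continuous_closed_preimage)
  moreover have "bounded {x \<in> S. c \<le> f x}"
    using assms(1) by (rule bounded_subset) auto
  ultimately show ?thesis by (simp add: compact_eq_bounded_closed)
qed

lemma unit_normal_eq_sgn: "unit_normal F u x = sgn (grad u x + F x)"
  by (simp add: unit_normal_def sgn_div_norm)

text \<open>Test the inequality \<open>div (N(u) - N(v)) \<ge> 0\<close> against \<open>\<psi> * ((u - v - \<epsilon>)\<^sup>+)\<^sup>2\<close>, where the
  cutoff \<open>\<psi>\<close> removes the singular set at an arbitrarily small cost in \<open>\<integral> |grad \<psi>|\<close>.\<close>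

lemma unit_normals_eq:
  fixes \<Omega> :: "(real^'n) set"
  assumes "open \<Omega>" "bounded \<Omega>"
    and u: "Ck_on 2 u \<Omega>" "continuous_on (closure \<Omega>) u"
    and v: "Ck_on 2 v \<Omega>" "continuous_on (closure \<Omega>) v"
    and F: "Ck_on 1 F \<Omega>"
    and curv: "\<And>x. x \<in> \<Omega> - (singular_set \<Omega> F u \<union> singular_set \<Omega> F v)
                 \<Longrightarrow> mean_curv F v x \<le> mean_curv F u x"
    and bdry: "\<And>x. x \<in> frontier \<Omega> \<Longrightarrow> u x \<le> v x"
    and null: "hausdorff_measure (CARD('n) - 1)
                 (closure (singular_set \<Omega> F u \<union> singular_set \<Omega> F v)) = 0"
    and z: "z \<in> \<Omega> - (singular_set \<Omega> F u \<union> singular_set \<Omega> F v)" "v z < u z"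
  shows "unit_normal F u z = unit_normal F v z"
proof (rule ccontr)
  assume neq: "unit_normal F u z \<noteq> unit_normal F v z"
  \<comment> \<open>Half the gap at \<open>z\<close>: positive, so that the superlevel set stays
    away from the frontier, and below the gap, so that \<open>z\<close> lies strictly inside
    it.\<close>
  define \<epsilon> where "\<epsilon> = (u z - v z) / 2"
  have "\<epsilon> > 0" "\<epsilon> < u z - v z" using z by (auto simp: \<epsilon>_def)
  define S where "S = singular_set \<Omega> F u \<union> singular_set \<Omega> F v"
  define w where "w x = u x - v x" for x
  define \<phi> where "\<phi> x = sqpos (w x - \<epsilon>)" for x
  define p where "p x = grad u x + F x" for x
  define q where "q x = grad v x + F x" for x
  define N where "N x = unit_normal F u x - unit_normal F v x" for x
  define D where "D x = grad \<phi> x \<bullet> N x" for x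
  define L where "L = {x \<in> \<Omega>. \<epsilon> \<le> w x}"
  have S_def': "S = {x \<in> \<Omega>. p x = 0} \<union> {x \<in> \<Omega>. q x = 0}"
    by (auto simp: S_def singular_set_def p_def q_def)
  have p_C1: "C1_on (\<lambda>x. p x $ i) \<Omega>" and q_C1: "C1_on (\<lambda>x. q x $ i) \<Omega>" for i
    unfolding p_def q_def vector_add_component
    by (intro C1_on_add Ck_on_2_grad Ck_on_1_component u v F)+
  have cont: "continuous_on \<Omega> p" "continuous_on \<Omega> q"
    using p_C1 q_C1 by (auto intro!: continuous_on_vec_components dest: C1_onD(4))
  have w_C1: "C1_on w \<Omega>" unfolding w_def[abs_def] by (intro C1_on_diff Ck_on_2_C1_on u v)
  have \<phi>_C1: "C1_on \<phi> \<Omega>"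
    unfolding \<phi>_def[abs_def] by (intro C1_on_sqpos C1_on_diff C1_on_const w_C1)
  have grad_\<phi>: "grad \<phi> x = (2 * max 0 (w x - \<epsilon>)) *\<^sub>R (p x - q x)" if "x \<in> \<Omega>" for x
  proof -
    have d: "u differentiable (at x)" "v differentiable (at x)" "w differentiable (at x)"
      using C1_onD(1) Ck_on_2_C1_on u v w_C1 that by blast+
    have "grad \<phi> x = (2 * max 0 (w x - \<epsilon>)) *\<^sub>R grad w x"
      unfolding \<phi>_def[abs_def] using d by (simp add: grad_sqpos grad_diff)
    also have "grad w x = p x - q x"
      unfolding w_def[abs_def] using d by (simp add: grad_diff p_def q_def)
    finally show ?thesis .
  qed
  have "open (\<Omega> \<inter> p -` (- {0}))" "open (\<Omega> \<inter> q -` (- {0}))"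
    using cont \<open>open \<Omega>\<close> by (auto intro!: continuous_open_preimage)
  moreover have \<Omega>S: "\<Omega> - S = (\<Omega> \<inter> p -` (- {0})) \<inter> (\<Omega> \<inter> q -` (- {0}))"
    by (auto simp: S_def')
  ultimately have "open (\<Omega> - S)" by (metis open_Int)
  \<comment> \<open>Inside \<Omega> the singular set is relatively closed, being a union of zero
    sets of continuous fields.\<close>
  have closure_S: "closure S \<inter> \<Omega> \<subseteq> S"
  proof
    fix x assume x: "x \<in> closure S \<inter> \<Omega>"
    show "x \<in> S"
    proof (rule ccontr)
      assume "x \<notin> S"
      then have "(\<Omega> - S) \<inter> S \<noteq> {}"
        using x \<open>open (\<Omega> - S)\<close> open_Int_closure_eq_empty[of "\<Omega> - S" S] by blast
      then show False by blast
    qed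
  qed
  have nz: "p x \<noteq> 0" "q x \<noteq> 0" if "x \<in> \<Omega> - S" for x
    using that by (auto simp: S_def')
  have Nu_C1: "C1_on (\<lambda>x. unit_normal F u x $ i) (\<Omega> - S)"
    and Nv_C1: "C1_on (\<lambda>x. unit_normal F v x $ i) (\<Omega> - S)" for i
    unfolding unit_normal_eq_sgn p_def[symmetric] q_def[symmetric]
    using p_C1 q_C1 nz by (auto intro!: C1_on_sgn intro: C1_on_subset)
  then have N_C1: "C1_on (\<lambda>x. N x $ i) (\<Omega> - S)" for i
    unfolding N_def vector_minus_component by (intro C1_on_diff)
  \<comment> \<open>On the support of the truncation, \<open>p - q\<close> is the gradient of
    \<open>w\<close>, so \<open>inner_diff_sgn\<close> gives the sign of the main term.\<close>
  have D_eq: "D x = 2 * max 0 (w x - \<epsilon>) * ((norm (p x) + norm (q x)) / 2 * (norm (N x))\<^sup>2)"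
    if "x \<in> \<Omega> - S" for x
    using inner_diff_sgn[OF nz[OF that]] that
    by (simp add: D_def grad_\<phi> N_def unit_normal_eq_sgn p_def[symmetric] q_def[symmetric])
  then have D_nonneg: "D x \<ge> 0" if "x \<in> \<Omega> - S" for x using that by simp
  have D_cont: "continuous_on (\<Omega> - S) D"
    unfolding D_def[abs_def]
  proof (rule continuous_on_inner)
    show "continuous_on (\<Omega> - S) (grad \<phi>)"
      using C1_onD(3)[OF \<phi>_C1] by (rule continuous_on_subset) auto
    show "continuous_on (\<Omega> - S) N"
      using C1_onD(4)[OF N_C1] by (rule continuous_on_vec_components)
  qed
  have "D z > 0"
  proof -
    have "z \<in> \<Omega> - S" using z by (simp add: S_def)
    moreover have "0 < norm (p z) + norm (q z)"
      using nz[OF \<open>z \<in> \<Omega> - S\<close>] by (simp add: add_pos_pos)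
    moreover have "0 < norm (N z)" "0 < w z - \<epsilon>"
      using neq \<open>\<epsilon> < u z - v z\<close> by (simp_all add: N_def w_def)
    ultimately show ?thesis by (simp add: D_eq)
  qed

  \<comment> \<open>Choice of the cutoff\<close>
  have "compact L"
    unfolding L_def
  proof (rule compact_superlevel_set)
    show "continuous_on (closure \<Omega>) w"
      unfolding w_def[abs_def] by (intro continuous_intros u v)
    show "w x < \<epsilon>" if "x \<in> frontier \<Omega>" for x
      using bdry[OF that] \<open>\<epsilon> > 0\<close> by (simp add: w_def)
  qed (rule \<open>bounded \<Omega>\<close>)
  have "L \<subseteq> \<Omega>" by (auto simp: L_def)
  have "open {x \<in> \<Omega> - S. \<epsilon> < w x}"
    using \<open>open (\<Omega> - S)\<close> C1_onD(4)[OF w_C1]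
    by (intro open_strict_superlevel_set) (auto intro: continuous_on_subset)
  moreover have "continuous_on {x \<in> \<Omega> - S. \<epsilon> < w x} D"
    using D_cont by (rule continuous_on_subset) auto
  moreover have "z \<in> {x \<in> \<Omega> - S. \<epsilon> < w x}"
    using z \<open>\<epsilon> < u z - v z\<close> by (auto simp: S_def w_def)
  ultimately obtain \<rho> where \<rho>: "\<rho> > 0" "cball z \<rho> \<subseteq> {x \<in> \<Omega> - S. \<epsilon> < w x}"
    "\<forall>x\<in>cball z \<rho>. D z / 2 \<le> D x"
    using \<open>D z > 0\<close> by (rule continuous_pos_cball) (rule that)
  \<comment> \<open>A lower bound for the integral of \<psi> times \<open>D\<close>, coming from the
    half ball alone. It is fixed before the cutoff is chosen and does not depend on it.\<close>
  define c where "c = D z / 2 * measure lborel (cball z (\<rho> / 2))"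
  have "c > 0"
    using \<open>D z > 0\<close> \<rho>(1) content_cball_pos[of "\<rho> / 2" z] by (simp add: c_def)
  have "compact (\<phi> ` L)"
    using \<open>compact L\<close> C1_onD(4)[OF \<phi>_C1] \<open>L \<subseteq> \<Omega>\<close>
    by (intro compact_continuous_image) (auto intro: continuous_on_subset)
  then obtain M where M: "M > 0" "\<And>x. x \<in> L \<Longrightarrow> \<phi> x \<le> M"
    using compact_imp_bounded bounded_pos[of "\<phi> ` L"] by force
  have "compact (closure S \<inter> L)"
    using \<open>compact L\<close> by (simp add: closed_Int_compact)
  \<comment> \<open>The first number makes the error \<open>2 * M\<close> times the integral of
    \<open>g\<close> smaller than \<open>c\<close>. The second makes \<psi> equal to 1 on the half
    ball, since the whole ball around \<open>z\<close> misses the singular set.\<close>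
  moreover have "0 < c / (2 * M)" "0 < \<rho> / 2"
    using \<open>c > 0\<close> M \<rho> by auto
  ultimately obtain \<psi> g :: "real^'n \<Rightarrow> real" and U where \<psi>: "C1_on \<psi> UNIV" "\<forall>x. 0 \<le> \<psi> x"
    "open U" "closure S \<inter> L \<subseteq> U" "\<forall>x\<in>U. \<psi> x = 0"
    "\<forall>x. (\<forall>y\<in>closure S \<inter> L. dist y x > \<rho> / 2) \<longrightarrow> \<psi> x = 1"
    and g: "\<forall>x. norm (grad \<psi> x) \<le> g x" "\<forall>x. 0 \<le> g x" "integrable lborel g"
    "integral\<^sup>L lborel g < c / (2 * M)"
    by (rule hausdorff_null_cutoff[OF null[folded S_def] _ Int_lower1]) (rule that)
  have \<psi>1: "\<psi> x = 1" if x: "x \<in> cball z (\<rho> / 2)" for x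
  proof (rule \<psi>(6)[rule_format])
    fix y assume "y \<in> closure S \<inter> L"
    then have "y \<in> S" using closure_S \<open>L \<subseteq> \<Omega>\<close> by auto
    then have "y \<notin> cball z \<rho>" using \<rho>(2) by auto
    then show "dist y x > \<rho> / 2"
      using x dist_triangle[of z y x] by (simp add: dist_commute)
  qed

  \<comment> \<open>The divergence of the test field\<close>
  define K where "K = L - U"
  have "compact K" unfolding K_def using \<open>compact L\<close> \<open>open U\<close> by (rule compact_diff)
  have "K \<subseteq> \<Omega> - S"
    using \<psi>(4) closure_subset[of S] \<open>L \<subseteq> \<Omega>\<close> by (auto simp: K_def)
  define G where "G x = (\<psi> x * \<phi> x) *\<^sub>R N x" for x
  have \<psi>_C1: "C1_on \<psi> (\<Omega> - S)" using \<psi>(1) by (rule C1_on_subset) auto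
  have \<psi>\<phi>_C1: "C1_on (\<lambda>x. \<psi> x * \<phi> x) (\<Omega> - S)"
    using \<psi>_C1 C1_on_subset[OF \<phi>_C1] by (intro C1_on_mult) auto
  have G_C1: "C1_on (\<lambda>x. G x $ i) (\<Omega> - S)" for i
    unfolding G_def vector_scaleR_component real_scaleR_def by (intro C1_on_mult \<psi>\<phi>_C1 N_C1)
  \<comment> \<open>Outside \<open>L\<close> the factor \<phi> vanishes, and on \<open>U\<close> the
    factor \<psi> does.\<close>
  have G0: "G x = 0" if "x \<in> (\<Omega> - S) - K" for x
    using that \<psi>(5) by (auto simp: G_def K_def L_def \<phi>_def sqpos_def)
  note int_G = integral_divergence_compact_support[OF \<open>open (\<Omega> - S)\<close> \<open>compact K\<close> \<open>K \<subseteq> \<Omega> - S\<close> G_C1 G0]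
  \<comment> \<open>The product rule gives three terms: the curvature term is nonnegative, the main
    term is kept, and the cutoff term is at least \<open>- 2 * M * g x\<close> because \<phi> is at
    most \<open>M\<close> on \<open>L\<close> and \<open>N\<close>, a difference of unit vectors,
    has norm at most 2.\<close>
  have div_ge: "\<psi> x * D x - 2 * M * g x \<le> divergence G x" if "x \<in> K" for x
  proof -
    have x: "x \<in> \<Omega> - S" "x \<in> L" "x \<in> \<Omega>" using that \<open>K \<subseteq> \<Omega> - S\<close> by (auto simp: K_def)
    have d: "\<psi> differentiable (at x)" "\<phi> differentiable (at x)" "(\<lambda>x. \<psi> x * \<phi> x) differentiable (at x)"
      "(\<lambda>x. N x $ i) differentiable (at x)" for i
      using C1_onD(1)[OF \<psi>_C1] C1_onD(1)[OF \<phi>_C1] C1_onD(1)[OF \<psi>\<phi>_C1] C1_onD(1)[OF N_C1] x by auto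
    have "divergence N x = mean_curv F u x - mean_curv F v x"
      unfolding N_def[abs_def] mean_curv_def
      using C1_onD(1)[OF Nu_C1 x(1)] C1_onD(1)[OF Nv_C1 x(1)] by (rule divergence_diff)
    then have divN: "divergence N x \<ge> 0"
      using curv[of x] x(1) by (simp add: S_def)
    have "divergence G x = \<psi> x * \<phi> x * divergence N x + grad (\<lambda>x. \<psi> x * \<phi> x) x \<bullet> N x"
      unfolding G_def[abs_def] using d(3,4) by (rule divergence_scaleR)
    also have "grad (\<lambda>x. \<psi> x * \<phi> x) x \<bullet> N x = \<psi> x * D x + \<phi> x * (grad \<psi> x \<bullet> N x)"
      using d by (simp add: grad_mult inner_add_left D_def)
    finally have eq: "divergence G x
      = \<psi> x * \<phi> x * divergence N x + (\<psi> x * D x + \<phi> x * (grad \<psi> x \<bullet> N x))" .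
    have "norm (N x) \<le> 1 + 1"
      unfolding N_def unit_normal_eq_sgn
      by (rule order_trans[OF norm_triangle_ineq4 add_mono]) (simp_all add: norm_sgn)
    then have "\<bar>grad \<psi> x \<bullet> N x\<bar> \<le> g x * 2"
      using g(1,2)
      by (intro order_trans[OF Cauchy_Schwarz_ineq2 mult_mono]) auto
    then have "\<bar>\<phi> x * (grad \<psi> x \<bullet> N x)\<bar> \<le> M * (g x * 2)"
      using M x sqpos_nonneg[of "w x - \<epsilon>"] unfolding abs_mult
      by (intro mult_mono) (auto simp: \<phi>_def)
    moreover have "0 \<le> \<psi> x * \<phi> x * divergence N x"
      using divN \<psi>(2) by (simp add: \<phi>_def sqpos_nonneg)
    ultimately show ?thesis unfolding eq by (simp add: abs_le_iff)
  qed
  have int_D: "set_integrable lborel K (\<lambda>x. \<psi> x * D x)"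
    unfolding set_integrable_def
  proof (rule borel_integrable_compact[OF \<open>compact K\<close>])
    show "continuous_on K (\<lambda>x. \<psi> x * D x)"
      using C1_onD(4)[OF \<psi>_C1] D_cont \<open>K \<subseteq> \<Omega> - S\<close>
      by (intro continuous_on_mult) (auto intro: continuous_on_subset)
  qed
  have K_sets: "K \<in> sets lborel" using \<open>compact K\<close> by (simp add: borel_compact)
  have int_g: "set_integrable lborel K (\<lambda>x. 2 * M * g x)"
    unfolding set_integrable_def
  proof (rule integrable_mult_indicator[OF K_sets])
    show "integrable lborel (\<lambda>x. 2 * M * g x)" using g(3) by (intro integrable_mult_right)
  qed
  have "c \<le> (LINT x:K|lborel. \<psi> x * D x)"
    unfolding c_def
  proof (rule set_integral_ge_ball[OF int_D])
    show "0 \<le> \<psi> x * D x" if "x \<in> K" for x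
      using that \<open>K \<subseteq> \<Omega> - S\<close> \<psi>(2) D_nonneg by (auto intro!: mult_nonneg_nonneg)
    show "cball z (\<rho> / 2) \<subseteq> K"
    proof
      fix x assume x: "x \<in> cball z (\<rho> / 2)"
      then have "x \<in> cball z \<rho>" using \<rho>(1) by auto
      \<comment> \<open>The cutoff is 0 on \<open>U\<close> but 1 on the half ball.\<close>
      moreover have "x \<notin> U" using \<psi>(5) \<psi>1[OF x] by force
      ultimately show "x \<in> K" using \<rho>(2) by (auto simp: K_def L_def)
    qed
    show "D z / 2 \<le> \<psi> x * D x" if "x \<in> cball z (\<rho> / 2)" for x
      using that \<psi>1[OF that] \<rho>(1,3) by auto
  qed (use \<open>D z > 0\<close> in auto)
  \<comment> \<open>Subtraction of the error integral is monotone, so the chain continues with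
    \<open>c\<close> minus that integral on the left; the integral of the divergence at its other
    end is 0.\<close>
  also have "\<dots> - (LINT x:K|lborel. 2 * M * g x) = (LINT x:K|lborel. \<psi> x * D x - 2 * M * g x)"
    by (rule set_integral_diff(2)[OF int_D int_g, symmetric])
  also have "\<dots> \<le> (LINT x:K|lborel. divergence G x)"
    using set_integral_diff(1)[OF int_D int_g] int_G(1) div_ge by (rule set_integral_mono)
  finally have "c \<le> (LINT x:K|lborel. 2 * M * g x)"
    using int_G(2) by simp
  also have "\<dots> \<le> (\<integral>x. 2 * M * g x \<partial>lborel)"
    unfolding set_lebesgue_integral_def
    using int_g g(2,3) M(1) by (intro integral_mono) (auto simp: set_integrable_def indicator_def)
  also have "\<dots> < c"
    using g(4) M(1) by (simp add: field_simps)
  finally show False by simp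
qed

theorem theoremC:
  fixes \<Omega> :: "(real^'n) set"
    and u v :: "real^'n \<Rightarrow> real"
    and F :: "real^'n \<Rightarrow> real^'n"
    and a :: "real^'n^'n"
  assumes dim: "CARD('n) \<ge> 2"
    and domain: "open \<Omega>" "connected \<Omega>" "\<Omega> \<noteq> {}" "bounded \<Omega>"
    and skew: "\<And>j k. a $ j $ k + a $ k $ j = 0"
    and u: "Ck_on 2 u \<Omega>" "continuous_on (closure \<Omega>) u"
    and v: "Ck_on 2 v \<Omega>" "continuous_on (closure \<Omega>) v"
    and F: "Ck_on 1 F \<Omega>" "continuous_on (closure \<Omega>) F"
    and curv: "\<And>x. x \<in> \<Omega> - (singular_set \<Omega> F u \<union> singular_set \<Omega> F v)
                 \<Longrightarrow> mean_curv F v x \<le> mean_curv F u x"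
    and bdry: "\<And>x. x \<in> frontier \<Omega> \<Longrightarrow> v x \<ge> u x"
    and null: "hausdorff_measure (CARD('n) - 1)
                 (closure (singular_set \<Omega> F u \<union> singular_set \<Omega> F v)) = 0"
    and sign: "(\<forall>x\<in>\<Omega>. divergence (b_field a F) x > 0) \<or>
               (\<forall>x\<in>\<Omega>. divergence (b_field a F) x < 0)"
  shows "\<forall>x\<in>\<Omega>. v x \<ge> u x"
proof (rule ballI, rule ccontr)
  fix z assume "z \<in> \<Omega>" "\<not> u z \<le> v z"
  \<comment> \<open>As before, the level lies strictly between 0 and the gap at
    \<open>z\<close>.\<close>
  define \<epsilon> where "\<epsilon> = (u z - v z) / 2"
  have \<epsilon>: "\<epsilon> > 0" "\<epsilon> < u z - v z" using \<open>\<not> u z \<le> v z\<close> by (auto simp: \<epsilon>_def)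
  define w where "w x = u x - v x" for x
  define \<phi> where "\<phi> x = sqpos (w x - \<epsilon>)" for x
  define p where "p x = grad u x + F x" for x
  define q where "q x = grad v x + F x" for x
  define L where "L = {x \<in> \<Omega>. \<epsilon> \<le> w x}"
  define B where "B = divergence (b_field a F)"
  have bF: "b_field a F = (\<lambda>x. a *v F x)"
    by (simp add: b_field_def matrix_vector_mult_def fun_eq_iff)
  have p_C1: "C1_on (\<lambda>x. p x $ i) \<Omega>" for i
    unfolding p_def vector_add_component
    by (intro C1_on_add Ck_on_2_grad Ck_on_1_component u F)
  have w_C1: "C1_on w \<Omega>" unfolding w_def[abs_def] by (intro C1_on_diff Ck_on_2_C1_on u v)
  have \<phi>_C1: "C1_on \<phi> \<Omega>"
    unfolding \<phi>_def[abs_def] by (intro C1_on_sqpos C1_on_diff C1_on_const w_C1)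

  \<comment> \<open>If \<open>p x = 0\<close> this is trivial, and if \<open>q x = 0\<close> it is
    skewness. Otherwise equal unit normals make \<open>q x\<close> a multiple of \<open>p x\<close>,
    so \<open>p x - q x\<close> is one too, and skewness applies again.\<close>
  have orth: "(a *v p x) \<bullet> (p x - q x) = 0" if "x \<in> \<Omega>" "v x < u x" for x
  proof (cases "p x = 0 \<or> q x = 0")
    case True
    then show ?thesis using skew_matrix_inner_eq_0[OF skew, of "p x"] by auto
  next
    case False
    have "unit_normal F u x = unit_normal F v x"
      using False that
      by (intro unit_normals_eq[OF domain(1,4) u v F(1) curv bdry null])
         (auto simp: singular_set_def p_def q_def)
    then have "sgn (p x) = sgn (q x)"
      by (simp add: unit_normal_eq_sgn p_def q_def)
    moreover have "q x = norm (q x) *\<^sub>R sgn (q x)" using False by (simp add: sgn_div_norm)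
    ultimately have "q x = norm (q x) *\<^sub>R (p x /\<^sub>R norm (p x))" by (simp add: sgn_div_norm)
    then obtain t where "q x = t *\<^sub>R p x" by simp
    then show ?thesis
      using skew_matrix_inner_eq_0[OF skew, of "p x"] by (simp add: inner_diff_right)
  qed

  \<comment> \<open>The skew test field and its divergence\<close>
  have "compact L"
    unfolding L_def
  proof (rule compact_superlevel_set)
    show "continuous_on (closure \<Omega>) w"
      unfolding w_def[abs_def] by (intro continuous_intros u v)
    show "w x < \<epsilon>" if "x \<in> frontier \<Omega>" for x
      using bdry[OF that] \<open>\<epsilon> > 0\<close> by (simp add: w_def)
  qed (rule domain)
  have "L \<subseteq> \<Omega>" by (auto simp: L_def)
  define G where "G x = \<phi> x *\<^sub>R (a *v p x)" for x
  have ap_C1: "C1_on (\<lambda>x. (a *v p x) $ i) \<Omega>" for i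
    by (intro C1_on_matrix_mult p_C1)
  have G_C1: "C1_on (\<lambda>x. G x $ i) \<Omega>" for i
    unfolding G_def vector_scaleR_component real_scaleR_def by (intro C1_on_mult \<phi>_C1 ap_C1)
  have G0: "G x = 0" if "x \<in> \<Omega> - L" for x
    using that by (auto simp: G_def L_def \<phi>_def sqpos_def)
  note int_G = integral_divergence_compact_support[OF domain(1) \<open>compact L\<close> \<open>L \<subseteq> \<Omega>\<close> G_C1 G0]
  \<comment> \<open>The part of the divergence containing second derivatives of \<open>u\<close>
    vanishes by skewness, and the term with the gradient of \<phi> vanishes by
    \<open>orth\<close>.\<close>
  have div_G: "divergence G x = \<phi> x * B x" if "x \<in> \<Omega>" for x
  proof -
    have d: "u differentiable (at x)" "v differentiable (at x)" "w differentiable (at x)"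
      "\<phi> differentiable (at x)" "(\<lambda>x. (a *v p x) $ i) differentiable (at x)"
      "(\<lambda>x. (a *v grad u x) $ i) differentiable (at x)" "(\<lambda>x. (a *v F x) $ i) differentiable (at x)" for i
      using C1_onD(1)[OF _ that] Ck_on_2_C1_on u v w_C1 \<phi>_C1 ap_C1
        C1_on_matrix_mult[OF Ck_on_2_grad[OF u(1)]] C1_on_matrix_mult[OF Ck_on_1_component[OF F(1)]]
      by blast+
    have "divergence (\<lambda>x. a *v p x) x = divergence (\<lambda>x. a *v grad u x + a *v F x) x"
      by (simp add: p_def[abs_def] matrix_vector_right_distrib)
    also have "\<dots> = divergence (\<lambda>x. a *v grad u x) x + B x"
      unfolding B_def bF using d(6,7) by (rule divergence_add)
    finally have div: "divergence (\<lambda>x. a *v p x) x = B x"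
      using divergence_skew_grad_eq_0[OF skew domain(1) that u(1)] by simp
    have "grad \<phi> x = (2 * max 0 (w x - \<epsilon>)) *\<^sub>R grad w x"
      unfolding \<phi>_def[abs_def] using d by (simp add: grad_sqpos grad_diff)
    also have "grad w x = p x - q x"
      unfolding w_def[abs_def] using d by (simp add: grad_diff p_def q_def)
    finally have "grad \<phi> x \<bullet> (a *v p x) = 2 * max 0 (w x - \<epsilon>) * ((a *v p x) \<bullet> (p x - q x))"
      by (simp add: inner_commute)
    \<comment> \<open>Where \<open>v x < u x\<close> does not hold, \<open>w x\<close> is at most 0,
      so the truncation factor is 0.\<close>
    also have "\<dots> = 0"
      using orth[OF that] \<epsilon>(1) by (cases "v x < u x") (auto simp: w_def)
    finally show ?thesis
      unfolding G_def[abs_def] using d(4,5) div by (simp add: divergence_scaleR)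
  qed
  \<comment> \<open>The factor \<open>s\<close>, taken as 1 or -1, treats both signs of the
    divergence at once: the integral of \<open>s * (\<phi> x * B x)\<close> over \<open>L\<close> is
    positive near \<open>z\<close> and nonnegative elsewhere, yet equals \<open>s\<close> times an
    integral that vanishes.\<close>
  have contradiction: False if s: "\<And>x. x \<in> \<Omega> \<Longrightarrow> 0 < s * B x" for s
  proof -
    have \<phi>z: "\<phi> z > 0" using \<epsilon> by (simp add: \<phi>_def sqpos_def w_def)
    have "continuous_on \<Omega> B"
      unfolding B_def bF
      by (intro continuous_on_divergence C1_on_matrix_mult Ck_on_1_component F)
    then have c: "continuous_on \<Omega> (\<lambda>x. s * (\<phi> x * B x))"
      using C1_onD(4)[OF \<phi>_C1] by (intro continuous_intros)
    have "open {x \<in> \<Omega>. \<epsilon> < w x}"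
      using domain(1) C1_onD(4)[OF w_C1] by (rule open_strict_superlevel_set)
    moreover have "continuous_on {x \<in> \<Omega>. \<epsilon> < w x} (\<lambda>x. s * (\<phi> x * B x))"
      using c by (rule continuous_on_subset) auto
    moreover have "z \<in> {x \<in> \<Omega>. \<epsilon> < w x}" using \<open>z \<in> \<Omega>\<close> \<epsilon> by (simp add: w_def)
    moreover have pos: "0 < s * (\<phi> z * B z)"
      using mult_pos_pos[OF \<phi>z s[OF \<open>z \<in> \<Omega>\<close>]] by (simp add: mult.left_commute)
    ultimately obtain \<rho> where \<rho>: "\<rho> > 0" "cball z \<rho> \<subseteq> {x \<in> \<Omega>. \<epsilon> < w x}"
      "\<forall>x\<in>cball z \<rho>. s * (\<phi> z * B z) / 2 \<le> s * (\<phi> x * B x)"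
      by (rule continuous_pos_cball) (rule that)
    have "s * (\<phi> z * B z) / 2 * measure lborel (cball z \<rho>) \<le> (LINT x:L|lborel. s * (\<phi> x * B x))"
    proof (rule set_integral_ge_ball)
      show "set_integrable lborel L (\<lambda>x. s * (\<phi> x * B x))"
        unfolding set_integrable_def
        using \<open>compact L\<close> continuous_on_subset[OF c \<open>L \<subseteq> \<Omega>\<close>] by (rule borel_integrable_compact)
      show "0 \<le> s * (\<phi> x * B x)" if "x \<in> L" for x
      proof -
        have "0 \<le> \<phi> x * (s * B x)"
          using mult_nonneg_nonneg[of "\<phi> x" "s * B x"] that \<open>L \<subseteq> \<Omega>\<close> s[of x]
          by (auto simp: \<phi>_def sqpos_nonneg less_imp_le)
        then show ?thesis by (simp add: mult.left_commute)
      qed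
    qed (use \<rho> pos in \<open>auto simp: L_def\<close>)
    also have "\<dots> = s * (LINT x:L|lborel. divergence G x)"
      using div_G \<open>L \<subseteq> \<Omega>\<close> domain(1) \<open>compact L\<close>
      by (subst set_integral_mult_right[symmetric], intro set_lebesgue_integral_cong)
         (auto simp: borel_compact)
    also have "\<dots> = 0" using int_G(2) by simp
    finally show False
      using mult_pos_pos[OF half_gt_zero[OF pos] content_cball_pos[OF \<rho>(1), of z]] by simp
  qed
  show False
    using sign contradiction[of 1] contradiction[of "-1"] by (auto simp: B_def)
qed

end
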